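(* For every set $X$, the free left Ehresmann monoid $\mathrm{FLE}(X)$ is weakly coherent, that is, it is both weakly left coherent and weakly right coherent.
   Context: A monoid $S$ is weakly right coherent if every finitely generated right ideal of $S$ is finitely presented as a right $S$-act, i.e. isomorphic, as a right $S$-act, to a quotient of a free right $S$-act on a finite set by a finitely generated right $S$-act congruence. Weakly left coherent is the left-right dual. An $X$-tree is a finite directed graph $T$ whose underlying undirected graph is a tree, with edges labelled by elements of $X$, together with two distinguished (possibly equal) vertices, the start vertex and the end vertex, such that there is a (possibly empty) directed path (the trunk) from the start vertex to the end vertex. It is left Ehresmann if there is a directed path from the start vertex to every vertex. A morphism of $X$-trees maps vertices to vertices and edges to edges, preserving incidence, orientation and labels, and sends start vertex to start vertex and end vertex to end vertex. A retraction of $T$ is an idempotent morphism $T\to T$; $T$ is pruned if its only retraction is the identity. For each $X$-tree $T$ there is a pruned tree $\overline T$, unique up to isomorphism, that is the image of a retraction of $T$. Trees are considered up to isomorphism. $S\times T$ is the tree obtained by gluing the end vertex of $S$ to the start vertex of $T$ (start vertex that of $S$, end vertex that of $T$), and $T^{(+)}$ is $T$ with its end vertex moved to its start vertex. $\mathrm{FLE}(X)$ is the set of isomorphism types of pruned left Ehresmann $X$-trees with $ST=\overline{S\times T}$, $T^+=\overline{T^{(+)}}$ and identity the single-vertex tree. It is the free left Ehresmann monoid on $X$; here it is regarded simply as a monoid. *)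

theory Defs
  imports "HOL-Algebra.Group" "HOL.Hull"
begin

section \<open>Acts over a monoid and weak coherence\<close>

record ('m, 's) ract = "'m partial_object" +
  act :: "'m \<Rightarrow> 's \<Rightarrow> 'm"

definition ract_iso ::
  "('s, 'z) monoid_scheme \<Rightarrow> ('m, 's) ract \<Rightarrow> ('n, 's) ract \<Rightarrow> bool" where
  "ract_iso S M N \<longleftrightarrow> (\<exists>f. bij_betw f (carrier M) (carrier N) \<and>
     (\<forall>m\<in>carrier M. \<forall>s\<in>carrier S. f (act M m s) = act N (f m) s))"

definition free_ract :: "('s, 'z) monoid_scheme \<Rightarrow> 'i set \<Rightarrow> ('i \<times> 's, 's) ract" where
  "free_ract S I = \<lparr>carrier = I \<times> carrier S, act = (\<lambda>(i, t) s. (i, t \<otimes>\<^bsub>S\<^esub> s))\<rparr>"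

definition ract_congruence ::
  "('s, 'z) monoid_scheme \<Rightarrow> ('m, 's) ract \<Rightarrow> ('m \<times> 'm) set \<Rightarrow> bool" where
  "ract_congruence S M \<rho> \<longleftrightarrow> equiv (carrier M) \<rho> \<and>
     (\<forall>(m, m')\<in>\<rho>. \<forall>s\<in>carrier S. (act M m s, act M m' s) \<in> \<rho>)"

definition fg_ract_congruence ::
  "('s, 'z) monoid_scheme \<Rightarrow> ('m, 's) ract \<Rightarrow> ('m \<times> 'm) set \<Rightarrow> bool" where
  "fg_ract_congruence S M \<rho> \<longleftrightarrow>
     (\<exists>H. finite H \<and> H \<subseteq> carrier M \<times> carrier M \<and> \<rho> = (ract_congruence S M) hull H)"

text \<open>For a congruence \<open>\<rho>\<close>, the action below sends the class of \<open>m\<close> and \<open>s\<close> to the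
  class of \<open>m \<cdot> s\<close>.\<close>

definition quot_ract :: "('m, 's) ract \<Rightarrow> ('m \<times> 'm) set \<Rightarrow> ('m set, 's) ract" where
  "quot_ract M \<rho> =
     \<lparr>carrier = carrier M // \<rho>, act = (\<lambda>C s. \<rho> `` ((\<lambda>m. act M m s) ` C))\<rparr>"

text \<open>Every finite set is in bijection with a finite set of naturals, so it suffices to let
  the free generators range over the latter.\<close>

definition fp_ract :: "('s, 'z) monoid_scheme \<Rightarrow> ('m, 's) ract \<Rightarrow> bool" where
  "fp_ract S M \<longleftrightarrow> (\<exists>(I :: nat set) \<rho>. finite I \<and>
     fg_ract_congruence S (free_ract S I) \<rho> \<and>
     ract_iso S M (quot_ract (free_ract S I) \<rho>))"

text \<open>The empty set counts as a right ideal, generated by the empty set; it is presented by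
  the free act on no generators.\<close>

definition right_ideal :: "('s, 'z) monoid_scheme \<Rightarrow> 's set \<Rightarrow> bool" where
  "right_ideal S R \<longleftrightarrow> R \<subseteq> carrier S \<and> (\<forall>a\<in>R. \<forall>s\<in>carrier S. a \<otimes>\<^bsub>S\<^esub> s \<in> R)"

definition fg_right_ideal :: "('s, 'z) monoid_scheme \<Rightarrow> 's set \<Rightarrow> bool" where
  "fg_right_ideal S R \<longleftrightarrow>
     (\<exists>A. finite A \<and> A \<subseteq> carrier S \<and> R = (right_ideal S) hull A)"

definition weakly_right_coherent :: "('s, 'z) monoid_scheme \<Rightarrow> bool" where
  "weakly_right_coherent S \<longleftrightarrow> monoid S \<and>
     (\<forall>R. fg_right_ideal S R \<longrightarrow> fp_ract S \<lparr>carrier = R, act = (\<otimes>\<^bsub>S\<^esub>)\<rparr>)"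

definition opposite_monoid :: "('s, 'z) monoid_scheme \<Rightarrow> 's monoid" where
  "opposite_monoid S =
     \<lparr>carrier = carrier S, mult = (\<lambda>a b. b \<otimes>\<^bsub>S\<^esub> a), one = \<one>\<^bsub>S\<^esub>\<rparr>"

definition weakly_left_coherent :: "('s, 'z) monoid_scheme \<Rightarrow> bool" where
  "weakly_left_coherent S \<longleftrightarrow> weakly_right_coherent (opposite_monoid S)"

definition weakly_coherent :: "('s, 'z) monoid_scheme \<Rightarrow> bool" where
  "weakly_coherent S \<longleftrightarrow> weakly_left_coherent S \<and> weakly_right_coherent S"

section \<open>Labelled trees\<close>

text \<open>An edge \<open>(u, x, v)\<close> goes from \<open>u\<close> to \<open>v\<close> and has label \<open>x\<close>. Two parallel edges with
  the same label cannot be represented, but they would form a cycle in the underlying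
  undirected multigraph. Parallel edges with distinct labels, antiparallel edges and loops can
  be represented and are excluded by acyclicity (cycles of length two and one).\<close>

record ('v, 'x) xtree =
  tverts :: "'v set"
  tedges :: "('v \<times> 'x \<times> 'v) set"
  tstart :: 'v
  tend :: 'v

definition dstep :: "('v, 'x) xtree \<Rightarrow> ('v \<times> 'v) set" where
  "dstep T = {(u, v). \<exists>x. (u, x, v) \<in> tedges T}"

definition joins :: "'v \<times> 'x \<times> 'v \<Rightarrow> 'v \<Rightarrow> 'v \<Rightarrow> bool" where
  "joins e u v \<longleftrightarrow> (\<exists>x. e = (u, x, v) \<or> e = (v, x, u))"

definition undirected_cycle ::
  "('v, 'x) xtree \<Rightarrow> 'v list \<Rightarrow> ('v \<times> 'x \<times> 'v) list \<Rightarrow> bool" where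
  "undirected_cycle T vs es \<longleftrightarrow>
     es \<noteq> [] \<and> length vs = length es \<and> distinct vs \<and> distinct es \<and> set es \<subseteq> tedges T \<and>
     (\<forall>i<length es. joins (es ! i) (vs ! i) (vs ! (Suc i mod length es)))"

definition underlying_tree :: "('v, 'x) xtree \<Rightarrow> bool" where
  "underlying_tree T \<longleftrightarrow> tverts T \<noteq> {} \<and>
     (\<forall>u\<in>tverts T. \<forall>v\<in>tverts T. (u, v) \<in> (dstep T \<union> (dstep T)\<inverse>)\<^sup>*) \<and>
     (\<nexists>vs es. undirected_cycle T vs es)"

definition is_xtree :: "'x set \<Rightarrow> ('v, 'x) xtree \<Rightarrow> bool" where
  "is_xtree X T \<longleftrightarrow>
     finite (tverts T) \<and> finite (tedges T) \<and> tedges T \<subseteq> tverts T \<times> X \<times> tverts T \<and>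
     underlying_tree T \<and> tstart T \<in> tverts T \<and> tend T \<in> tverts T \<and>
     (tstart T, tend T) \<in> (dstep T)\<^sup>*"

definition left_ehresmann :: "('v, 'x) xtree \<Rightarrow> bool" where
  "left_ehresmann T \<longleftrightarrow> (\<forall>v\<in>tverts T. (tstart T, v) \<in> (dstep T)\<^sup>*)"

text \<open>A morphism is given by its vertex map: preservation of incidence, orientation and labels
  forces an edge \<open>(u, x, v)\<close> to go to \<open>(f u, x, f v)\<close>.\<close>

definition edge_map :: "('v \<Rightarrow> 'w) \<Rightarrow> 'v \<times> 'x \<times> 'v \<Rightarrow> 'w \<times> 'x \<times> 'w" where
  "edge_map f = (\<lambda>(u, x, v). (f u, x, f v))"

definition xtree_morphism ::
  "('v, 'x) xtree \<Rightarrow> ('w, 'x) xtree \<Rightarrow> ('v \<Rightarrow> 'w) \<Rightarrow> bool" where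
  "xtree_morphism S T f \<longleftrightarrow>
     f ` tverts S \<subseteq> tverts T \<and> edge_map f ` tedges S \<subseteq> tedges T \<and>
     f (tstart S) = tstart T \<and> f (tend S) = tend T"

definition xtree_iso :: "('v, 'x) xtree \<Rightarrow> ('w, 'x) xtree \<Rightarrow> bool" where
  "xtree_iso S T \<longleftrightarrow> (\<exists>f. xtree_morphism S T f \<and>
     bij_betw f (tverts S) (tverts T) \<and> bij_betw (edge_map f) (tedges S) (tedges T))"

definition xtree_image :: "('v \<Rightarrow> 'w) \<Rightarrow> ('v, 'x) xtree \<Rightarrow> ('w, 'x) xtree" where
  "xtree_image f T = \<lparr>tverts = f ` tverts T, tedges = edge_map f ` tedges T,
     tstart = f (tstart T), tend = f (tend T)\<rparr>"

definition retraction_of :: "('v, 'x) xtree \<Rightarrow> ('v \<Rightarrow> 'v) \<Rightarrow> bool" where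
  "retraction_of T r \<longleftrightarrow> xtree_morphism T T r \<and> (\<forall>v\<in>tverts T. r (r v) = r v)"

definition pruned :: "('v, 'x) xtree \<Rightarrow> bool" where
  "pruned T \<longleftrightarrow> (\<forall>r. retraction_of T r \<longrightarrow> (\<forall>v\<in>tverts T. r v = v))"

text \<open>\<open>U\<close> is (a copy of) the pruned tree associated with \<open>T\<close>.\<close>

definition pruning_of :: "('v, 'x) xtree \<Rightarrow> ('w, 'x) xtree \<Rightarrow> bool" where
  "pruning_of T U \<longleftrightarrow>
     pruned U \<and> (\<exists>r. retraction_of T r \<and> xtree_iso (xtree_image r T) U)"

text \<open>The product glues disjoint copies of \<open>S\<close> and \<open>T\<close>; the start vertex of \<open>T\<close> is
  represented by the end vertex of \<open>S\<close>.\<close>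

definition glue_right :: "('v, 'x) xtree \<Rightarrow> ('w, 'x) xtree \<Rightarrow> 'w \<Rightarrow> 'v + 'w" where
  "glue_right S T w = (if w = tstart T then Inl (tend S) else Inr w)"

definition xtree_prod :: "('v, 'x) xtree \<Rightarrow> ('w, 'x) xtree \<Rightarrow> ('v + 'w, 'x) xtree" where
  "xtree_prod S T =
     \<lparr>tverts = Inl ` tverts S \<union> glue_right S T ` tverts T,
      tedges = edge_map Inl ` tedges S \<union> edge_map (glue_right S T) ` tedges T,
      tstart = Inl (tstart S), tend = glue_right S T (tend T)\<rparr>"

section \<open>The free left Ehresmann monoid\<close>

text \<open>The isomorphism type of a finite tree is represented by the set of all trees with
  vertices in \<open>nat\<close> that are isomorphic to it.\<close>

definition iso_type :: "('v, 'x) xtree \<Rightarrow> (nat, 'x) xtree set" where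
  "iso_type T = {U. xtree_iso T U}"

text \<open>The product of two isomorphism types consists of all prunings of products of their
  representatives. It is again a single isomorphism type, because pruned retracts are unique
  up to isomorphism.\<close>

definition FLE :: "'x set \<Rightarrow> (nat, 'x) xtree set monoid" where
  "FLE X =
     \<lparr>carrier = {iso_type T | T :: (nat, 'x) xtree.
                   is_xtree X T \<and> left_ehresmann T \<and> pruned T},
      mult = (\<lambda>A B. {U. \<exists>S\<in>A. \<exists>T\<in>B. pruning_of (xtree_prod S T) U}),
      one = iso_type \<lparr>tverts = {0 :: nat}, tedges = {}, tstart = 0, tend = 0\<rparr>\<rparr>"

end

theory Submission
  imports Defs
begin

text \<open>Call two left Ehresmann trees equivalent if there are morphisms between them in both directions.
A pruned tree is a core, so a class contains exactly one pruned tree up to isomorphism, and an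
element of \<open>FLE X\<close> is the same as a class. The class of a tree is described by data that
can be multiplied and compared by hand. Let \<open>v\<^sub>0 \<rightarrow> v\<^sub>1 \<rightarrow> \<dots> \<rightarrow> v\<^sub>n\<close> be the trunk, with labels
\<open>x\<^sub>1, \<dots>, x\<^sub>n\<close>, and let the theory \<open>U\<^sub>i\<close> of \<open>v\<^sub>i\<close> be the set of all rooted trees with a single edge at the
root that can be mapped into the tree with the root going to \<open>v\<^sub>i\<close>. Theories are ordered by
inclusion and joined by union. Write \<open>\<diamond>\<^sub>x U\<close> for the theory of a vertex whose only outgoing edge
has label \<open>x\<close> and leads to a vertex with theory \<open>U\<close>. A tree maps to another one if and only if
the trunks have the same labels and the theories along the first trunk are contained in those
along the second (\<open>tree_value_le\<close>, \<open>morphism_of_trunk_le\<close>). So the class is the sequence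
\<open>(U\<^sub>0, x\<^sub>1, U\<^sub>1, \<dots>, x\<^sub>n, U\<^sub>n)\<close>, and the sequences that occur are those of finitely generated theories with
\<open>\<diamond>\<^sub>x U\<^sub>i\<^sub>+\<^sub>1 \<subseteq> U\<^sub>i\<close> for \<open>x = x\<^sub>i\<^sub>+\<^sub>1\<close> and all \<open>i < n\<close>. They are called trunks below.

In a product of trunks the last theory of the first factor is joined with the first theory of
the second factor. The later theories do not change; the earlier ones absorb what has become
true at their successor, one after the other, from right to left. In particular all theories
of \<open>a \<star> u\<close> at vertices of \<open>a\<close> are determined by \<open>a\<close> and the theory at the end of \<open>a\<close>.

A monoid is weakly right coherent if every intersection of two principal right ideals is empty
or principal, and every right annihilator congruence \<open>{(u, v). a u = a v}\<close> is the one of an element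
\<open>e\<close> with \<open>a e = a\<close>, because such a congruence is generated by the pair \<open>(1, e)\<close>
(\<open>weakly_right_coherent_criterion\<close>). Trunks satisfy this on both sides:

\<^item> For right annihilators take for \<open>e\<close> the trunk of length \<open>0\<close> with the last theory of \<open>a\<close>, for left
  annihilators the one with the first theory of \<open>a\<close>.

\<^item> Let \<open>a \<star> u = b \<star> v\<close>, where the word of \<open>b\<close> extends that of \<open>a\<close>. The equation says that certain
  finitely generated theories hold at vertices of \<open>b\<close> within \<open>b \<star> v\<close>. Each of these conditions is
  impossible, or amounts to a condition of the same kind at the next vertex, and so finally to finitely many trees lying in the first theory of \<open>v\<close>
  (\<open>principal_mem_product\<close>). Adding exactly these trees to the last theory of \<open>b\<close> gives the
  generator of the intersection (\<open>generates_meet_trunk\<close>).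

\<^item> If \<open>u \<star> a = v \<star> b\<close> and \<open>a\<close> is shorter than \<open>b\<close>, then \<open>b\<close> itself is a left multiple of \<open>a\<close>. If the
  lengths agree, then \<open>a\<close> and \<open>b\<close> differ only in their first theories, and the generator arises
  from joining these (\<open>equal_length_left_multiples\<close>).\<close>

section \<open>A criterion for weak right coherence\<close>

text \<open>The pairs \<open>(u, v)\<close> with \<open>a u = a v\<close> form a right congruence. Under this condition it is generated by
\<open>(1, e)\<close>: from \<open>e u = e v\<close> the chain \<open>u, e u = e v, v\<close> is obtained.\<close>

definition represents_right_annihilator :: "('s, 'z) monoid_scheme \<Rightarrow> 's \<Rightarrow> 's \<Rightarrow> bool" where
  "represents_right_annihilator S a e \<longleftrightarrow> e \<in> carrier S \<and> a \<otimes>\<^bsub>S\<^esub> e = a \<and>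
     (\<forall>u\<in>carrier S. \<forall>v\<in>carrier S. a \<otimes>\<^bsub>S\<^esub> u = a \<otimes>\<^bsub>S\<^esub> v \<longrightarrow> e \<otimes>\<^bsub>S\<^esub> u = e \<otimes>\<^bsub>S\<^esub> v)"

text \<open>The right ideals of \<open>a\<close> and \<open>b\<close> meet in the right ideal generated by \<open>a p = b q\<close>.\<close>

definition generates_meet :: "('s, 'z) monoid_scheme \<Rightarrow> 's \<Rightarrow> 's \<Rightarrow> 's \<Rightarrow> 's \<Rightarrow> bool" where
  "generates_meet S a b p q \<longleftrightarrow> p \<in> carrier S \<and> q \<in> carrier S \<and> a \<otimes>\<^bsub>S\<^esub> p = b \<otimes>\<^bsub>S\<^esub> q \<and>
     (\<forall>u\<in>carrier S. \<forall>v\<in>carrier S. a \<otimes>\<^bsub>S\<^esub> u = b \<otimes>\<^bsub>S\<^esub> v \<longrightarrow>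
       (\<exists>s\<in>carrier S. a \<otimes>\<^bsub>S\<^esub> u = a \<otimes>\<^bsub>S\<^esub> p \<otimes>\<^bsub>S\<^esub> s))"

lemma generates_meetI:
  assumes "p \<in> carrier S" "q \<in> carrier S" "a \<otimes>\<^bsub>S\<^esub> p = b \<otimes>\<^bsub>S\<^esub> q"
    and "\<And>u v. u \<in> carrier S \<Longrightarrow> v \<in> carrier S \<Longrightarrow> a \<otimes>\<^bsub>S\<^esub> u = b \<otimes>\<^bsub>S\<^esub> v \<Longrightarrow>
      \<exists>s\<in>carrier S. a \<otimes>\<^bsub>S\<^esub> u = a \<otimes>\<^bsub>S\<^esub> p \<otimes>\<^bsub>S\<^esub> s"
  shows "generates_meet S a b p q"
  unfolding generates_meet_def using assms by blast

definition right_annihilators_represented :: "('s, 'z) monoid_scheme \<Rightarrow> bool" where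
  "right_annihilators_represented S \<longleftrightarrow>
     (\<forall>a\<in>carrier S. \<exists>e. represents_right_annihilator S a e)"

definition meets_principal :: "('s, 'z) monoid_scheme \<Rightarrow> bool" where
  "meets_principal S \<longleftrightarrow> (\<forall>a\<in>carrier S. \<forall>b\<in>carrier S.
     (\<exists>u\<in>carrier S. \<exists>v\<in>carrier S. a \<otimes>\<^bsub>S\<^esub> u = b \<otimes>\<^bsub>S\<^esub> v) \<longrightarrow>
     (\<exists>p q. generates_meet S a b p q))"

lemma right_ideal_hull_eq:
  assumes "monoid S" "A \<subseteq> carrier S"
  shows "right_ideal S hull A = {a \<otimes>\<^bsub>S\<^esub> s | a s. a \<in> A \<and> s \<in> carrier S}"
proof -
  interpret monoid S by fact
  show ?thesis
  proof (rule hull_unique)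
    show "A \<subseteq> {a \<otimes>\<^bsub>S\<^esub> s | a s. a \<in> A \<and> s \<in> carrier S}"
    proof
      fix a assume "a \<in> A"
      then have "a = a \<otimes>\<^bsub>S\<^esub> \<one>\<^bsub>S\<^esub>" using assms(2) by auto
      then show "a \<in> {a \<otimes>\<^bsub>S\<^esub> s | a s. a \<in> A \<and> s \<in> carrier S}" using \<open>a \<in> A\<close> by blast
    qed
    show "right_ideal S {a \<otimes>\<^bsub>S\<^esub> s | a s. a \<in> A \<and> s \<in> carrier S}"
      unfolding right_ideal_def
    proof (intro conjI ballI)
      show "{a \<otimes>\<^bsub>S\<^esub> s | a s. a \<in> A \<and> s \<in> carrier S} \<subseteq> carrier S" using assms(2) by auto
    next
      fix b t assume "b \<in> {a \<otimes>\<^bsub>S\<^esub> s | a s. a \<in> A \<and> s \<in> carrier S}" and t: "t \<in> carrier S"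
      then obtain a s where "b = a \<otimes>\<^bsub>S\<^esub> s" "a \<in> A" "s \<in> carrier S" by blast
      then have "b \<otimes>\<^bsub>S\<^esub> t = a \<otimes>\<^bsub>S\<^esub> (s \<otimes>\<^bsub>S\<^esub> t)" "s \<otimes>\<^bsub>S\<^esub> t \<in> carrier S" "a \<in> A"
        using assms(2) t by (auto simp: m_assoc)
      then show "b \<otimes>\<^bsub>S\<^esub> t \<in> {a \<otimes>\<^bsub>S\<^esub> s | a s. a \<in> A \<and> s \<in> carrier S}" by blast
    qed
  qed (auto simp: right_ideal_def)
qed

text \<open>Present the right ideal generated by \<open>g\<^sub>0, \<dots>, g\<^sub>n\<^sub>-\<^sub>1\<close> by one free generator for each \<open>g\<^sub>i\<close>, subject to the
relations \<open>(i, 1) = (i, e\<^sub>i)\<close>, where \<open>e\<^sub>i\<close> represents the annihilator of \<open>g\<^sub>i\<close>, and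
\<open>(i, p\<^sub>i\<^sub>j) = (j, q\<^sub>i\<^sub>j)\<close> for all \<open>i\<close>, \<open>j\<close> such that the ideals of \<open>g\<^sub>i\<close> and \<open>g\<^sub>j\<close> meet. If \<open>g\<^sub>i u = g\<^sub>j v\<close>, then this element is
\<open>g\<^sub>i p\<^sub>i\<^sub>j s\<close> for some \<open>s\<close>. The relations of the first kind identify \<open>(i, u)\<close> with \<open>(i, p\<^sub>i\<^sub>j s)\<close> and \<open>(j, v)\<close> with
\<open>(j, q\<^sub>i\<^sub>j s)\<close>, and those of the second kind identify these two.\<close>

lemma weakly_right_coherent_criterion:
  assumes S: "monoid S" and canc: "right_annihilators_represented S" and meets: "meets_principal S"
  shows "weakly_right_coherent S"
  unfolding weakly_right_coherent_def
proof (intro conjI allI impI)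
  interpret monoid S by fact
  fix R assume "fg_right_ideal S R"
  then obtain A where A: "finite A" "A \<subseteq> carrier S" "R = right_ideal S hull A"
    by (auto simp: fg_right_ideal_def)
  have R: "R = {a \<otimes>\<^bsub>S\<^esub> s | a s. a \<in> A \<and> s \<in> carrier S}"
    using right_ideal_hull_eq[OF S A(2)] A(3) by simp
  define I where "I = {0..<card A}"
  have finI: "finite I" by (simp add: I_def)
  obtain g where "bij_betw g I A"
    using ex_bij_betw_nat_finite[OF A(1)] by (auto simp: I_def)
  then have gA: "g ` I = A" by (simp add: bij_betw_def)
  then have g: "g i \<in> carrier S" if "i \<in> I" for i using A(2) that by auto
  have "\<forall>i\<in>I. \<exists>e. represents_right_annihilator S (g i) e"
    using canc g unfolding right_annihilators_represented_def by blast
  from bchoice[OF this] obtain e where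
    e_repr: "\<And>i. i \<in> I \<Longrightarrow> represents_right_annihilator S (g i) (e i)" by blast
  have e: "e i \<in> carrier S" "g i \<otimes>\<^bsub>S\<^esub> e i = g i" if "i \<in> I" for i
    using e_repr[OF that] unfolding represents_right_annihilator_def by blast+
  have e_cancel: "e i \<otimes>\<^bsub>S\<^esub> u = e i \<otimes>\<^bsub>S\<^esub> v"
    if "i \<in> I" "u \<in> carrier S" "v \<in> carrier S" "g i \<otimes>\<^bsub>S\<^esub> u = g i \<otimes>\<^bsub>S\<^esub> v" for i u v
    using e_repr[OF that(1)] that unfolding represents_right_annihilator_def by blast
  define J where "J = {(i, j). i \<in> I \<and> j \<in> I \<and>
     (\<exists>u\<in>carrier S. \<exists>v\<in>carrier S. g i \<otimes>\<^bsub>S\<^esub> u = g j \<otimes>\<^bsub>S\<^esub> v)}"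
  have finJ: "finite J"
    by (rule finite_subset[of _ "I \<times> I"]) (auto simp: J_def finI)
  have JD: "i \<in> I" "j \<in> I" if "(i, j) \<in> J" for i j
    using that by (simp_all add: J_def)
  have "\<forall>k\<in>J. \<exists>r. generates_meet S (g (fst k)) (g (snd k)) (fst r) (snd r)"
  proof
    fix k assume "k \<in> J"
    then have "g (fst k) \<in> carrier S" "g (snd k) \<in> carrier S"
      "\<exists>u\<in>carrier S. \<exists>v\<in>carrier S. g (fst k) \<otimes>\<^bsub>S\<^esub> u = g (snd k) \<otimes>\<^bsub>S\<^esub> v"
      using g unfolding J_def by force+
    then obtain p q where "generates_meet S (g (fst k)) (g (snd k)) p q"
      using meets unfolding meets_principal_def by blast
    then show "\<exists>r. generates_meet S (g (fst k)) (g (snd k)) (fst r) (snd r)"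
      by (intro exI[of _ "(p, q)"]) simp
  qed
  from bchoice[OF this] obtain r where r: "\<And>k. k \<in> J \<Longrightarrow>
      generates_meet S (g (fst k)) (g (snd k)) (fst (r k)) (snd (r k))" by blast
  define p where "p i j = fst (r (i, j))" for i j
  define q where "q i j = snd (r (i, j))" for i j
  have pq_meet: "generates_meet S (g i) (g j) (p i j) (q i j)" if "(i, j) \<in> J" for i j
    using r[OF that] by (simp add: p_def q_def)
  have pq: "p i j \<in> carrier S" "q i j \<in> carrier S" "g i \<otimes>\<^bsub>S\<^esub> p i j = g j \<otimes>\<^bsub>S\<^esub> q i j"
    if "(i, j) \<in> J" for i j using pq_meet[OF that] unfolding generates_meet_def by blast+
  define F where "F = free_ract S I"
  have F: "carrier F = I \<times> carrier S" "\<And>i t s. act F (i, t) s = (i, t \<otimes>\<^bsub>S\<^esub> s)"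
    by (auto simp: F_def free_ract_def)
  define val where "val = (\<lambda>(i, t). g i \<otimes>\<^bsub>S\<^esub> t)"
  define \<rho> where "\<rho> = {(m, m'). m \<in> carrier F \<and> m' \<in> carrier F \<and> val m = val m'}"
  have val_act: "val (act F m s) = val m \<otimes>\<^bsub>S\<^esub> s" if "m \<in> carrier F" "s \<in> carrier S" for m s
    using that g by (auto simp: F val_def m_assoc)
  have act_closed: "act F m s \<in> carrier F" if "m \<in> carrier F" "s \<in> carrier S" for m s
    using that by (auto simp: F)
  define H where "H = (\<lambda>i. ((i, \<one>\<^bsub>S\<^esub>), (i, e i))) ` I \<union> (\<lambda>(i, j). ((i, p i j), (j, q i j))) ` J"
  have H: "finite H" "H \<subseteq> carrier F \<times> carrier F"
    using finI finJ e pq JD by (auto simp: H_def F)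
  have \<rho>_cong: "ract_congruence S F \<rho>"
    unfolding ract_congruence_def
  proof
    show "equiv (carrier F) \<rho>"
      by (rule equivI) (auto simp: \<rho>_def refl_on_def sym_def trans_def)
    show "\<forall>(m, m')\<in>\<rho>. \<forall>s\<in>carrier S. (act F m s, act F m' s) \<in> \<rho>"
      by (auto simp: \<rho>_def val_act act_closed simp del: F)
  qed
  have hull: "ract_congruence S F hull H = \<rho>"
  proof (rule hull_unique)
    show "H \<subseteq> \<rho>"
      using e pq g JD by (auto simp: H_def \<rho>_def F val_def)
    show "ract_congruence S F \<rho>" by fact
    fix \<sigma> assume "H \<subseteq> \<sigma>" and \<sigma>: "ract_congruence S F \<sigma>"
    have eq: "equiv (carrier F) \<sigma>"
      and act: "\<And>i t j t' s. ((i, t), (j, t')) \<in> \<sigma> \<Longrightarrow> s \<in> carrier S \<Longrightarrow> ((i, t \<otimes>\<^bsub>S\<^esub> s), (j, t' \<otimes>\<^bsub>S\<^esub> s)) \<in> \<sigma>"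
      using \<sigma> by (fastforce simp: ract_congruence_def F)+
    have sym: "(b, a) \<in> \<sigma>" if "(a, b) \<in> \<sigma>" for a b
      using eq that by (auto simp: equiv_def dest: symD)
    have trans: "(a, c) \<in> \<sigma>" if "(a, b) \<in> \<sigma>" "(b, c) \<in> \<sigma>" for a b c
      using eq that by (auto simp: equiv_def dest: transD)
    have id: "((i, u), (i, e i \<otimes>\<^bsub>S\<^esub> u)) \<in> \<sigma>" if "i \<in> I" "u \<in> carrier S" for i u
    proof -
      have "((i, \<one>\<^bsub>S\<^esub>), (i, e i)) \<in> \<sigma>" using \<open>H \<subseteq> \<sigma>\<close> that by (auto simp: H_def)
      from act[OF this that(2)] show ?thesis using that by simp
    qed
    have same: "((i, u), (i, v)) \<in> \<sigma>"
      if "i \<in> I" "u \<in> carrier S" "v \<in> carrier S" "g i \<otimes>\<^bsub>S\<^esub> u = g i \<otimes>\<^bsub>S\<^esub> v" for i u v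
      using id[of i u] id[of i v] e_cancel[OF that] that sym trans by metis
    show "\<rho> \<subseteq> \<sigma>"
    proof clarify
      fix i u j v assume "((i, u), (j, v)) \<in> \<rho>"
      then have *: "i \<in> I" "u \<in> carrier S" "j \<in> I" "v \<in> carrier S" "g i \<otimes>\<^bsub>S\<^esub> u = g j \<otimes>\<^bsub>S\<^esub> v"
        by (auto simp: \<rho>_def F val_def)
      then have J: "(i, j) \<in> J" by (auto simp: J_def)
      obtain s where s: "s \<in> carrier S" "g i \<otimes>\<^bsub>S\<^esub> u = g i \<otimes>\<^bsub>S\<^esub> p i j \<otimes>\<^bsub>S\<^esub> s"
        using pq_meet[OF J] * unfolding generates_meet_def by blast
      have "((i, u), (i, p i j \<otimes>\<^bsub>S\<^esub> s)) \<in> \<sigma>"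
        using same[of i u "p i j \<otimes>\<^bsub>S\<^esub> s"] * s pq(1)[OF J] g by (simp add: m_assoc)
      moreover have "((i, p i j \<otimes>\<^bsub>S\<^esub> s), (j, q i j \<otimes>\<^bsub>S\<^esub> s)) \<in> \<sigma>"
        using act[of i "p i j" j "q i j" s] \<open>H \<subseteq> \<sigma>\<close> J s(1) by (force simp: H_def)
      moreover have "((j, q i j \<otimes>\<^bsub>S\<^esub> s), (j, v)) \<in> \<sigma>"
        using same[of j "q i j \<otimes>\<^bsub>S\<^esub> s" v] * s pq(2,3)[OF J] g by (simp add: m_assoc[symmetric])
      ultimately show "((i, u), (j, v)) \<in> \<sigma>" using trans by blast
    qed
  qed
  define f where "f = (\<lambda>r. {m \<in> carrier F. val m = r})"
  have R_val: "R = val ` carrier F"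
    unfolding R F(1) gA[symmetric] by (force simp: val_def)
  have class_eq: "\<rho> `` {m} = f (val m)" if "m \<in> carrier F" for m
    using that by (auto simp: \<rho>_def f_def)
  have bij: "bij_betw f R (carrier F // \<rho>)"
    unfolding bij_betw_def
  proof
    show "inj_on f R"
      unfolding R_val by (rule inj_onI) (auto simp: f_def simp del: F)
    show "f ` R = carrier F // \<rho>"
      unfolding R_val quotient_def by (auto simp: class_eq simp del: F)
  qed
  have hom: "f (r \<otimes>\<^bsub>S\<^esub> s) = \<rho> `` ((\<lambda>m. act F m s) ` f r)" if r: "r \<in> R" and s: "s \<in> carrier S" for r s
  proof -
    obtain m where m: "m \<in> carrier F" "val m = r" using r R_val by auto
    have "\<rho> `` {act F m' s} = f (r \<otimes>\<^bsub>S\<^esub> s)" if "m' \<in> f r" for m'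
      using that s by (simp add: class_eq[OF act_closed] val_act f_def del: F)
    moreover have "m \<in> f r" using m by (simp add: f_def del: F)
    ultimately have "(\<Union>m'\<in>f r. \<rho> `` {act F m' s}) = f (r \<otimes>\<^bsub>S\<^esub> s)" by blast
    then show ?thesis by blast
  qed
  have "ract_iso S \<lparr>carrier = R, act = (\<otimes>\<^bsub>S\<^esub>)\<rparr> (quot_ract F \<rho>)"
    unfolding ract_iso_def using bij hom by (intro exI[of _ f]) (simp add: quot_ract_def)
  moreover have "fg_ract_congruence S F \<rho>"
    unfolding fg_ract_congruence_def using H hull by blast
  ultimately show "fp_ract S \<lparr>carrier = R, act = (\<otimes>\<^bsub>S\<^esub>)\<rparr>"
    unfolding fp_ract_def F_def using finI by blast
qed (fact S)

lemma weakly_right_coherent_transfer: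
  assumes M: "monoid M" and one: "h \<one>\<^bsub>M\<^esub> = \<one>\<^bsub>S\<^esub>" and bij: "bij_betw h (carrier M) (carrier S)"
    and mult: "\<And>a b. a \<in> carrier M \<Longrightarrow> b \<in> carrier M \<Longrightarrow> h (a \<otimes>\<^bsub>M\<^esub> b) = h a \<otimes>\<^bsub>S\<^esub> h b"
    and canc: "right_annihilators_represented M" and meets: "meets_principal M"
  shows "weakly_right_coherent S"
proof (rule weakly_right_coherent_criterion)
  interpret M: monoid M by fact
  have S: "carrier S = h ` carrier M" and inj: "inj_on h (carrier M)"
    using bij by (auto simp: bij_betw_def)
  have eq: "h a = h b \<longleftrightarrow> a = b" if "a \<in> carrier M" "b \<in> carrier M" for a b
    using inj that by (rule inj_on_eq_iff)
  note [simp] = mult[symmetric] one[symmetric] eq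
  show "monoid S" by (rule monoidI) (auto simp: S M.m_assoc)
  show "right_annihilators_represented S"
    using canc unfolding right_annihilators_represented_def represents_right_annihilator_def S
    by (auto 0 4)
  show "meets_principal S"
    using meets unfolding meets_principal_def generates_meet_def S by simp blast
qed

section \<open>Theories: sets of rooted trees\<close>

text \<open>Finite rooted trees with labelled edges, in the encoding by left child and right sibling:
\<open>Br x t s\<close> is the rooted tree \<open>s\<close> with one more edge at its root, which has label \<open>x\<close> and leads to
the root of \<open>t\<close>. The pairs \<open>(x, t)\<close> stand for trees with a single edge at the root, and a theory
is a set of such pairs. Only these trees are needed, since a tree maps to a vertex if and only
if each of its branches does. Thus union is the join of theories.\<close>

datatype 'x branches = Leaf | Br 'x "'x branches" "'x branches"

primrec kids :: "'x branches \<Rightarrow> ('x \<times> 'x branches) set" where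
  "kids Leaf = {}"
| "kids (Br x t s) = insert (x, t) (kids s)"

text \<open>The theory of a vertex from which a single edge, labelled \<open>x\<close>, leads to a vertex with theory \<open>U\<close>.\<close>

definition dia :: "'x \<Rightarrow> ('x \<times> 'x branches) set \<Rightarrow> ('x \<times> 'x branches) set" where
  "dia x U = {x} \<times> {t. kids t \<subseteq> U}"

text \<open>The theory of the root of \<open>t\<close> within the tree \<open>t\<close> itself.\<close>

primrec down :: "'x branches \<Rightarrow> ('x \<times> 'x branches) set" where
  "down Leaf = {}"
| "down (Br x t s) = dia x (down t) \<union> down s"

primrec append_branches :: "'x branches \<Rightarrow> 'x branches \<Rightarrow> 'x branches" where
  "append_branches Leaf r = r"
| "append_branches (Br x t s) r = Br x t (append_branches s r)"

lemma kids_append [simp]: "kids (append_branches s r) = kids s \<union> kids r"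
  by (induction s) auto

lemma down_append [simp]: "down (append_branches s r) = down s \<union> down r"
  by (induction s) auto

lemma set_append_branches [simp]:
  "set_branches (append_branches s r) = set_branches s \<union> set_branches r"
  by (induction s) auto

lemma dia_mono: "U \<subseteq> V \<Longrightarrow> dia x U \<subseteq> dia x V"
  by (auto simp: dia_def)

lemma mem_dia [simp]: "(y, t) \<in> dia x U \<longleftrightarrow> y = x \<and> kids t \<subseteq> U"
  by (auto simp: dia_def)

lemma kids_subset_down: "kids t \<subseteq> down t"
  by (induction t) auto

definition fin_gen :: "'x set \<Rightarrow> ('x \<times> 'x branches) set \<Rightarrow> bool" where
  "fin_gen X U \<longleftrightarrow> (\<exists>t. set_branches t \<subseteq> X \<and> U = down t)"

lemma fin_gen_down: "set_branches t \<subseteq> X \<Longrightarrow> fin_gen X (down t)"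
  by (auto simp: fin_gen_def)

lemma fin_genE: assumes "fin_gen X U" obtains t where "set_branches t \<subseteq> X" "U = down t"
  using assms by (auto simp: fin_gen_def)

lemma fin_gen_empty [simp]: "fin_gen X {}"
  unfolding fin_gen_def by (rule exI[of _ Leaf]) simp

lemma fin_gen_Un: "fin_gen X U \<Longrightarrow> fin_gen X V \<Longrightarrow> fin_gen X (U \<union> V)"
  unfolding fin_gen_def by (metis down_append set_append_branches Un_least)

lemma fin_gen_dia: assumes "x \<in> X" "fin_gen X U" shows "fin_gen X (dia x U)"
proof -
  obtain t where "set_branches t \<subseteq> X" "U = down t" using assms(2) by (rule fin_genE)
  then show ?thesis using assms(1)
    unfolding fin_gen_def by (intro exI[of _ "Br x t Leaf"]) simp
qed

lemma down_eq_UN_kids: "down t = (\<Union>(y, s)\<in>kids t. dia y (down s))"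
  by (induction t) auto

text \<open>A theory of the form \<open>down s\<close> is closed under passing to trees that can be mapped to one of its
members. The induction composes such maps.\<close>

lemma down_least: "kids t \<subseteq> down s \<Longrightarrow> down t \<subseteq> down s"
proof (induction s arbitrary: t)
  case Leaf
  then show ?case by (cases t) auto
next
  case (Br x s1 s2)
  have "dia y (down r) \<subseteq> down (Br x s1 s2)" if "(y, r) \<in> kids t" for y r
  proof (cases "(y, r) \<in> dia x (down s1)")
    case True
    then have "y = x" "kids r \<subseteq> down s1" by simp_all
    then have "dia y (down r) \<subseteq> dia x (down s1)" using Br.IH(1)[of r] by (simp add: dia_mono)
    then show ?thesis by (simp add: le_supI1)
  next
    case False
    moreover have "(y, r) \<in> dia x (down s1) \<union> down s2" using Br.prems that by (simp only: down.simps) blast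
    ultimately have "kids (Br y r Leaf) \<subseteq> down s2" by auto
    from Br.IH(2)[OF this] have "dia y (down r) \<subseteq> down s2" by simp
    then show ?thesis by (simp add: le_supI2)
  qed
  then show ?case unfolding down_eq_UN_kids[of t] by blast
qed

text \<open>Inclusion of a generated theory is a finite condition, on the generators. This turns conditions
on products of trunks into statements about finitely many trees.\<close>

lemma down_subset_iff: "fin_gen X U \<Longrightarrow> down t \<subseteq> U \<longleftrightarrow> kids t \<subseteq> U"
  using down_least kids_subset_down unfolding fin_gen_def by blast

section \<open>The monoid of trunks\<close>

text \<open>The theories at the vertices of the trunk and the labels of its edges, from start to end.\<close>

datatype 'x trunk = End "('x \<times> 'x branches) set" | Step "('x \<times> 'x branches) set" 'x "'x trunk"

primrec first_theory :: "'x trunk \<Rightarrow> ('x \<times> 'x branches) set" where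
  "first_theory (End U) = U"
| "first_theory (Step U x m) = U"

primrec last_theory :: "'x trunk \<Rightarrow> ('x \<times> 'x branches) set" where
  "last_theory (End U) = U"
| "last_theory (Step U x m) = last_theory m"

primrec trunk_length :: "'x trunk \<Rightarrow> nat" where
  "trunk_length (End U) = 0"
| "trunk_length (Step U x m) = Suc (trunk_length m)"

primrec enlarge :: "('x \<times> 'x branches) set \<Rightarrow> 'x trunk \<Rightarrow> 'x trunk" where
  "enlarge U (End V) = End (U \<union> V)"
| "enlarge U (Step V x m) = Step (U \<union> V) x m"

text \<open>The trunk of a product of trees. The theory at a vertex of the first tree grows only through
what becomes true at the next vertex of its trunk.\<close>

primrec tmult :: "'x trunk \<Rightarrow> 'x trunk \<Rightarrow> 'x trunk" (infixl "\<star>" 70) where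
  "End U \<star> n = enlarge U n"
| "Step U x m \<star> n = Step (U \<union> dia x (first_theory (m \<star> n))) x (m \<star> n)"

text \<open>These are the trunks of left Ehresmann trees. The last condition holds because the edge to the
next vertex is among those that determine the theory of the current one.\<close>

primrec admissible :: "'x set \<Rightarrow> 'x trunk \<Rightarrow> bool" where
  "admissible X (End U) \<longleftrightarrow> fin_gen X U"
| "admissible X (Step U x m) \<longleftrightarrow>
     fin_gen X U \<and> x \<in> X \<and> admissible X m \<and> dia x (first_theory m) \<subseteq> U"

lemma first_enlarge [simp]: "first_theory (enlarge U m) = U \<union> first_theory m"
  by (cases m) auto

lemma length_enlarge [simp]: "trunk_length (enlarge U m) = trunk_length m"
  by (cases m) auto

lemma enlarge_enlarge [simp]: "enlarge U (enlarge V m) = enlarge (U \<union> V) m"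
  by (cases m) auto

lemma enlarge_id: "U \<subseteq> first_theory m \<Longrightarrow> enlarge U m = m"
  by (cases m) auto

lemma first_theory_mult_mono: "first_theory m \<subseteq> first_theory (m \<star> n)"
  by (cases m) auto

lemma enlarge_mult: "enlarge U m \<star> n = enlarge U (m \<star> n)"
  by (cases m) auto

lemma tmult_assoc: "(a \<star> b) \<star> c = a \<star> (b \<star> c)"
proof (induction a)
  case (End U)
  then show ?case by (simp add: enlarge_mult)
next
  case (Step U x m)
  have "dia x (first_theory (m \<star> b)) \<subseteq> dia x (first_theory (m \<star> (b \<star> c)))"
    using first_theory_mult_mono[of "m \<star> b" c] by (intro dia_mono) (simp add: Step)
  then show ?case using Step by auto
qed

lemma fin_gen_first: "admissible X m \<Longrightarrow> fin_gen X (first_theory m)"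
  by (cases m) auto

lemma fin_gen_last: "admissible X m \<Longrightarrow> fin_gen X (last_theory m)"
  by (induction m) auto

lemma admissible_enlarge: "fin_gen X U \<Longrightarrow> admissible X m \<Longrightarrow> admissible X (enlarge U m)"
  by (cases m) (auto simp: fin_gen_Un)

lemma admissible_mult: "admissible X m \<Longrightarrow> admissible X n \<Longrightarrow> admissible X (m \<star> n)"
  by (induction m) (auto simp: admissible_enlarge fin_gen_Un fin_gen_dia fin_gen_first)

lemma tmult_one: "admissible X m \<Longrightarrow> m \<star> End {} = m"
  by (induction m) auto

lemma length_mult: "trunk_length (m \<star> n) = trunk_length m + trunk_length n"
  by (induction m) auto

definition trunk_monoid :: "'x set \<Rightarrow> 'x trunk monoid" where
  "trunk_monoid X = \<lparr>carrier = {m. admissible X m}, mult = (\<star>), one = End {}\<rparr>"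

lemma trunk_monoid_simps [simp]:
  "carrier (trunk_monoid X) = {m. admissible X m}" "mult (trunk_monoid X) = (\<star>)"
  "\<one>\<^bsub>trunk_monoid X\<^esub> = End {}"
  by (auto simp: trunk_monoid_def)

lemma monoid_trunk_monoid: "monoid (trunk_monoid X)"
  by (rule monoidI) (auto simp: admissible_mult tmult_assoc tmult_one enlarge_id)

lemma opposite_simps [simp]:
  "carrier (opposite_monoid S) = carrier S" "a \<otimes>\<^bsub>opposite_monoid S\<^esub> b = b \<otimes>\<^bsub>S\<^esub> a"
  "\<one>\<^bsub>opposite_monoid S\<^esub> = \<one>\<^bsub>S\<^esub>"
  by (auto simp: opposite_monoid_def)

lemma monoid_opposite: assumes "monoid S" shows "monoid (opposite_monoid S)"
proof -
  interpret monoid S by fact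
  show ?thesis by (rule monoidI) (auto simp: m_assoc)
qed

section \<open>Right annihilators and meets of right ideals of trunks\<close>

lemma mult_last_eq: "a \<star> End (last_theory a) = a" if "admissible X a"
  using that by (induction a) auto

text \<open>A product \<open>a \<star> u\<close> depends on \<open>u\<close> only through its later part and the join of the last theory of \<open>a\<close>
with the first theory of \<open>u\<close>, and it determines both.\<close>

lemma left_cancel_last: "a \<star> u = a \<star> v \<Longrightarrow> End (last_theory a) \<star> u = End (last_theory a) \<star> v"
  by (induction a) auto

lemma represents_annihilator_last:
  assumes "admissible X a"
  shows "represents_right_annihilator (trunk_monoid X) a (End (last_theory a))"
  unfolding represents_right_annihilator_def
proof (intro conjI ballI impI)
  fix u v assume "a \<otimes>\<^bsub>trunk_monoid X\<^esub> u = a \<otimes>\<^bsub>trunk_monoid X\<^esub> v"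
  then show "End (last_theory a) \<otimes>\<^bsub>trunk_monoid X\<^esub> u = End (last_theory a) \<otimes>\<^bsub>trunk_monoid X\<^esub> v"
    using left_cancel_last[of a u v] by simp
qed (use assms in \<open>simp_all add: mult_last_eq fin_gen_last\<close>)

lemma right_annihilators_trunk: "right_annihilators_represented (trunk_monoid X)"
  unfolding right_annihilators_represented_def using represents_annihilator_last by auto

text \<open>Conditions on a factor \<open>v\<close> that are either unsatisfiable or say that \<open>v\<close> is fixed by left
multiplication with a certain trunk of length \<open>0\<close>, the one with theory \<open>down t\<close>.\<close>

definition principal_condition :: "'x set \<Rightarrow> ('x trunk \<Rightarrow> bool) \<Rightarrow> bool" where
  "principal_condition X Q \<longleftrightarrow> (\<forall>v. admissible X v \<longrightarrow> \<not> Q v) \<or>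
     (\<exists>t. set_branches t \<subseteq> X \<and> (\<forall>v. admissible X v \<longrightarrow> (Q v \<longleftrightarrow> kids t \<subseteq> first_theory v)))"

lemma principal_const: "principal_condition X (\<lambda>v. c)"
proof (cases c)
  case True
  then show ?thesis unfolding principal_condition_def by (intro disjI2 exI[of _ Leaf]) simp
qed (simp add: principal_condition_def)

lemma principal_conj:
  assumes "principal_condition X P" "principal_condition X Q"
  shows "principal_condition X (\<lambda>v. P v \<and> Q v)"
proof (cases "(\<forall>v. admissible X v \<longrightarrow> \<not> P v) \<or> (\<forall>v. admissible X v \<longrightarrow> \<not> Q v)")
  case True
  then show ?thesis by (auto simp: principal_condition_def)
next
  case False
  with assms(1) obtain s where s: "set_branches s \<subseteq> X"
    "\<And>v. admissible X v \<Longrightarrow> P v \<longleftrightarrow> kids s \<subseteq> first_theory v"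
    unfolding principal_condition_def by blast
  from False assms(2) obtain t where t: "set_branches t \<subseteq> X"
    "\<And>v. admissible X v \<Longrightarrow> Q v \<longleftrightarrow> kids t \<subseteq> first_theory v"
    unfolding principal_condition_def by blast
  from s t show ?thesis
    unfolding principal_condition_def by (intro disjI2 exI[of _ "append_branches s t"]) simp
qed

lemma principal_kids:
  assumes "\<And>y s. y \<in> X \<Longrightarrow> set_branches s \<subseteq> X \<Longrightarrow> principal_condition X (\<lambda>v. (y, s) \<in> W v)"
    and "set_branches t \<subseteq> X"
  shows "principal_condition X (\<lambda>v. kids t \<subseteq> W v)"
  using assms(2) by (induction t) (auto intro!: principal_const principal_conj assms(1))

text \<open>A tree \<open>(y, s)\<close> can lie in the first theory of \<open>b \<star> v\<close> for three reasons: it lies in that of \<open>b\<close>, and then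
the condition is void; or \<open>b\<close> has length \<open>0\<close> and the tree lies in the first theory of \<open>v\<close>; or \<open>y\<close> is the
first label of \<open>b\<close> and the branches of \<open>s\<close> hold at the next vertex.\<close>

lemma principal_mem_product:
  "admissible X b \<Longrightarrow> y \<in> X \<Longrightarrow> set_branches s \<subseteq> X \<Longrightarrow>
    principal_condition X (\<lambda>v. (y, s) \<in> first_theory (b \<star> v))"
proof (induction b arbitrary: y s)
  case (End V)
  show ?case
  proof (cases "(y, s) \<in> V")
    case True
    then show ?thesis using principal_const[of X True] by simp
  next
    case False
    then show ?thesis using End unfolding principal_condition_def
      by (intro disjI2 exI[of _ "Br y s Leaf"]) auto
  qed
next
  case (Step V x m)
  have "principal_condition X (\<lambda>v. kids s \<subseteq> first_theory (m \<star> v))"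
    using Step by (intro principal_kids) auto
  then show ?case
    by (cases "(y, s) \<in> V"; cases "y = x") (simp_all add: principal_const)
qed

lemma principal_subset_product:
  assumes "admissible X b" "fin_gen X U"
  shows "principal_condition X (\<lambda>v. U \<subseteq> first_theory (b \<star> v))"
proof -
  obtain t where t: "set_branches t \<subseteq> X" "U = down t" using assms(2) by (rule fin_genE)
  have "principal_condition X (\<lambda>v. kids t \<subseteq> first_theory (b \<star> v))"
    using assms(1) t(1) by (intro principal_kids principal_mem_product)
  moreover have "U \<subseteq> first_theory (b \<star> v) \<longleftrightarrow> kids t \<subseteq> first_theory (b \<star> v)" if "admissible X v" for v
    using down_subset_iff fin_gen_first admissible_mult[OF assms(1) that] t(2) by metis
  ultimately show ?thesis unfolding principal_condition_def by simp
qed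

text \<open>If the equation \<open>a \<star> u = b \<star> v\<close> implies that \<open>a \<star> u = a \<star> p \<star> s\<close> for a factor \<open>s\<close> with \<open>Q s\<close>, and conversely
such factors turn \<open>p\<close> and \<open>q\<close> into solutions, then the smallest factor satisfying \<open>Q\<close> gives the
generator of the intersection.\<close>

lemma meet_refine:
  assumes p: "admissible X p" and q: "admissible X q"
    and Q: "principal_condition X Q"
    and ex: "admissible X w" "Q w"
    and eq: "\<And>s. admissible X s \<Longrightarrow> Q s \<Longrightarrow> a \<star> p \<star> s = b \<star> q \<star> s"
    and all: "\<And>u v. admissible X u \<Longrightarrow> admissible X v \<Longrightarrow> a \<star> u = b \<star> v \<Longrightarrow>
       \<exists>s. admissible X s \<and> Q s \<and> a \<star> u = a \<star> p \<star> s"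
  shows "\<exists>p q. generates_meet (trunk_monoid X) a b p q"
proof -
  obtain t where t: "set_branches t \<subseteq> X"
    "\<And>v. admissible X v \<Longrightarrow> Q v \<longleftrightarrow> kids t \<subseteq> first_theory v"
    using Q ex unfolding principal_condition_def by metis
  define e where "e = End (down t)"
  have e: "admissible X e" "Q e"
    using t by (simp_all add: e_def fin_gen_down kids_subset_down)
  have absorb: "e \<star> s = s" if "admissible X s" "Q s" for s
    using that t down_subset_iff[OF fin_gen_first[OF that(1)]] by (simp add: e_def enlarge_id)
  have "generates_meet (trunk_monoid X) a b (p \<star> e) (q \<star> e)"
  proof (rule generates_meetI)
    show "a \<otimes>\<^bsub>trunk_monoid X\<^esub> (p \<star> e) = b \<otimes>\<^bsub>trunk_monoid X\<^esub> (q \<star> e)"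
      using eq[OF e] by (simp add: tmult_assoc)
    fix u v assume uv: "u \<in> carrier (trunk_monoid X)" "v \<in> carrier (trunk_monoid X)"
      "a \<otimes>\<^bsub>trunk_monoid X\<^esub> u = b \<otimes>\<^bsub>trunk_monoid X\<^esub> v"
    then obtain s where s: "admissible X s" "Q s" "a \<star> u = a \<star> p \<star> s" using all[of u v] by auto
    then have "a \<star> u = a \<star> (p \<star> e) \<star> s" using absorb[of s] by (simp add: tmult_assoc)
    then show "\<exists>s\<in>carrier (trunk_monoid X). a \<otimes>\<^bsub>trunk_monoid X\<^esub> u =
        a \<otimes>\<^bsub>trunk_monoid X\<^esub> (p \<star> e) \<otimes>\<^bsub>trunk_monoid X\<^esub> s"
      using s(1) by auto
  qed (use p q e in \<open>simp_all add: admissible_mult\<close>)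
  then show ?thesis by blast
qed

lemma generates_meet_sym:
  assumes "generates_meet S a b p q" shows "generates_meet S b a q p"
proof (rule generates_meetI)
  have eq: "a \<otimes>\<^bsub>S\<^esub> p = b \<otimes>\<^bsub>S\<^esub> q" using assms unfolding generates_meet_def by blast
  then show "b \<otimes>\<^bsub>S\<^esub> q = a \<otimes>\<^bsub>S\<^esub> p" by (rule sym)
  fix u v assume uv: "u \<in> carrier S" "v \<in> carrier S" "b \<otimes>\<^bsub>S\<^esub> u = a \<otimes>\<^bsub>S\<^esub> v"
  have "\<exists>s\<in>carrier S. a \<otimes>\<^bsub>S\<^esub> v = a \<otimes>\<^bsub>S\<^esub> p \<otimes>\<^bsub>S\<^esub> s"
    using assms uv(1,2) uv(3)[symmetric] unfolding generates_meet_def by blast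
  then show "\<exists>s\<in>carrier S. b \<otimes>\<^bsub>S\<^esub> u = b \<otimes>\<^bsub>S\<^esub> q \<otimes>\<^bsub>S\<^esub> s"
    by (simp only: eq uv(3))
qed (use assms in \<open>auto simp: generates_meet_def\<close>)

lemma generates_meet_End:
  assumes "admissible X (End U)" "admissible X b" "admissible X u" "admissible X v" "End U \<star> u = b \<star> v"
  shows "\<exists>p q. generates_meet (trunk_monoid X) b (End U) p q"
proof (rule meet_refine[where Q = "\<lambda>v. U \<subseteq> first_theory (b \<star> v)" and p = "End {}" and q = b])
  show "principal_condition X (\<lambda>v. U \<subseteq> first_theory (b \<star> v))"
    using assms by (intro principal_subset_product) auto
  show "U \<subseteq> first_theory (b \<star> v)" using assms(5)[symmetric] by simp
  show "b \<star> End {} \<star> s = End U \<star> b \<star> s" if "U \<subseteq> first_theory (b \<star> s)" for s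
    using that enlarge_id[of U "b \<star> s"] by (simp add: tmult_one[OF assms(2)] enlarge_mult)
  show "\<exists>s. admissible X s \<and> U \<subseteq> first_theory (b \<star> s) \<and> b \<star> u = b \<star> End {} \<star> s"
    if "admissible X u" "admissible X v" "b \<star> u = End U \<star> v" for u v
    using that by (intro exI[of _ u]) (auto simp: tmult_one[OF assms(2)])
qed (use assms in auto)

text \<open>Both trunks lose their first vertex in the induction step. A common multiple of the remaining
parts \<open>m\<close> and \<open>n\<close> is \<open>m \<star> p \<star> s\<close>, and it extends to a common multiple of \<open>a\<close> and \<open>b\<close> if and only if the
first theories \<open>U\<close> and \<open>V\<close> become equal after joining both with the theory \<open>W s\<close> that is inherited
from \<open>m \<star> p \<star> s\<close>. This is a principal condition on \<open>s\<close>.\<close>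

lemma generates_meet_trunk:
  "admissible X a \<Longrightarrow> admissible X b \<Longrightarrow> admissible X u \<Longrightarrow> admissible X v \<Longrightarrow> a \<star> u = b \<star> v \<Longrightarrow>
    \<exists>p q. generates_meet (trunk_monoid X) a b p q"
proof (induction a arbitrary: b)
  case (End U)
  then show ?case using generates_meet_End generates_meet_sym by metis
next
  case (Step U x m)
  show ?case
  proof (cases b)
    case (End V)
    then show ?thesis using generates_meet_End[of X V "Step U x m" v u] Step.prems by simp
  next
    case b: (Step V y n)
    have y: "y = x" and mn: "m \<star> u = n \<star> v" using Step.prems(5) by (auto simp: b)
    have coh: "admissible X m" "admissible X n" "fin_gen X U" "fin_gen X V" "x \<in> X"
      using Step.prems by (auto simp: b)
    obtain p q where "generates_meet (trunk_monoid X) m n p q"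
      using Step.IH[OF coh(1,2) Step.prems(3,4) mn] by blast
    then have pq: "admissible X p" "admissible X q" "m \<star> p = n \<star> q"
      and gen: "\<And>u v. admissible X u \<Longrightarrow> admissible X v \<Longrightarrow> m \<star> u = n \<star> v \<Longrightarrow>
        \<exists>s. admissible X s \<and> m \<star> u = m \<star> p \<star> s"
      by (auto simp: generates_meet_def)
    have c: "admissible X (m \<star> p)" using coh pq by (simp add: admissible_mult)
    define W where "W s = dia x (first_theory (m \<star> p \<star> s))" for s
    define Q where "Q s \<longleftrightarrow> U \<subseteq> V \<union> W s \<and> V \<subseteq> U \<union> W s" for s
    have join: "principal_condition X (\<lambda>s. A \<subseteq> B \<union> W s)" if "fin_gen X A" "fin_gen X B" for A B
    proof -
      \<comment> \<open>The theory \<open>B \<union> W s\<close> is the first theory of the product of this trunk with \<open>s\<close>.\<close>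
      have "admissible X (Step (B \<union> dia x (first_theory (m \<star> p))) x (m \<star> p))"
        using that c coh by (simp add: fin_gen_Un fin_gen_dia fin_gen_first)
      from principal_subset_product[OF this that(1)]
      have "principal_condition X
        (\<lambda>s. A \<subseteq> B \<union> dia x (first_theory (m \<star> p)) \<union> W s)" by (simp add: W_def)
      moreover have "B \<union> dia x (first_theory (m \<star> p)) \<union> W s = B \<union> W s" for s
        using dia_mono[OF first_theory_mult_mono, of x "m \<star> p" s] by (auto simp: W_def)
      ultimately show ?thesis by simp
    qed
    have agree: "Step U x m \<star> u = b \<star> v \<and> m \<star> u = m \<star> p \<star> s \<longleftrightarrow>
        m \<star> u = m \<star> p \<star> s \<and> n \<star> v = m \<star> p \<star> s \<and> Q s" for u v s
      by (auto simp: b y Q_def W_def)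
    obtain w where w: "admissible X w" "m \<star> u = m \<star> p \<star> w"
      using gen Step.prems(3,4) mn by blast
    show ?thesis
    proof (rule meet_refine[where Q = Q and p = p and q = q and w = w])
      show "principal_condition X Q"
        unfolding Q_def using coh by (intro principal_conj join)
      show "admissible X w" "Q w" using w agree[of u v w] Step.prems(5) by auto
      show "Step U x m \<star> p \<star> s = b \<star> q \<star> s" if "admissible X s" "Q s" for s
        using agree[of "p \<star> s" "q \<star> s" s] that pq(3)
        by (metis tmult_assoc)
      show "\<exists>s. admissible X s \<and> Q s \<and> Step U x m \<star> u = Step U x m \<star> p \<star> s"
        if uv: "admissible X u" "admissible X v" "Step U x m \<star> u = b \<star> v" for u v
      proof -
        have "m \<star> u = n \<star> v" using uv(3) by (simp add: b)
        then obtain s where s: "admissible X s" "m \<star> u = m \<star> p \<star> s" using gen uv by blast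
        then have "Q s" using agree[of u v s] uv(3) by auto
        moreover have "Step U x m \<star> u = Step U x m \<star> (p \<star> s)"
          using s(2) by (simp add: tmult_assoc)
        ultimately show ?thesis using s(1) tmult_assoc by metis
      qed
    qed (use Step.prems pq in auto)
  qed
qed

lemma meets_principal_trunk: "meets_principal (trunk_monoid X)"
  unfolding meets_principal_def using generates_meet_trunk by auto

section \<open>Left annihilators and meets of left ideals of trunks\<close>

lemma first_mult_eq: "first_theory (u \<star> a) = first_theory (u \<star> End (first_theory a))"
  by (induction u) auto

text \<open>In \<open>u \<star> a\<close> only the first theory of \<open>a\<close> influences the theories at the vertices of \<open>u\<close>.\<close>

lemma right_cancel_first:
  "u \<star> a = v \<star> a \<Longrightarrow> u \<star> End (first_theory a) = v \<star> End (first_theory a)"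
proof (induction u arbitrary: v)
  case (End U)
  then have "trunk_length v = 0" using length_mult[of v a] by (metis add_cancel_left_left tmult.simps(1) length_enlarge)
  then obtain V where "v = End V" by (cases v) auto
  then show ?case using End by (cases a) auto
next
  case (Step U x m)
  have "trunk_length v = Suc (trunk_length m)"
    using arg_cong[OF Step.prems, of trunk_length] by (simp add: length_mult)
  then obtain V y n where v: "v = Step V y n" by (cases v) auto
  have "m \<star> a = n \<star> a" using Step.prems v by simp
  then show ?case using Step v first_mult_eq[of m a] first_mult_eq[of n a] by auto
qed

lemma represents_annihilator_first:
  assumes "admissible X a"
  shows "represents_right_annihilator (opposite_monoid (trunk_monoid X)) a (End (first_theory a))"
  unfolding represents_right_annihilator_def
proof (intro conjI ballI impI)
  fix u v
  assume "a \<otimes>\<^bsub>opposite_monoid (trunk_monoid X)\<^esub> u = a \<otimes>\<^bsub>opposite_monoid (trunk_monoid X)\<^esub> v"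
  then show "End (first_theory a) \<otimes>\<^bsub>opposite_monoid (trunk_monoid X)\<^esub> u =
      End (first_theory a) \<otimes>\<^bsub>opposite_monoid (trunk_monoid X)\<^esub> v"
    using right_cancel_first[of u a v] by simp
qed (use assms in \<open>simp_all add: enlarge_id fin_gen_first\<close>)

lemma right_annihilators_opposite_trunk:
  "right_annihilators_represented (opposite_monoid (trunk_monoid X))"
  unfolding right_annihilators_represented_def using represents_annihilator_first by auto

text \<open>Comparing \<open>u \<star> a\<close> and \<open>v \<star> b\<close> from the right, \<open>a\<close> covers a proper final part of \<open>b\<close>. At the remaining
vertices \<open>b\<close> already contains all that a product with \<open>a\<close> would add, so \<open>b = w \<star> a\<close>, where \<open>w\<close> is the
part of \<open>u\<close> over the vertices of \<open>b\<close>, with its first theory replaced by that of \<open>b\<close>.\<close>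

lemma shorter_is_left_divisor:
  assumes "trunk_length a < trunk_length b"
  shows "u \<star> a = v \<star> b \<Longrightarrow> admissible X b \<Longrightarrow> admissible X u \<Longrightarrow> \<exists>w. admissible X w \<and> b = w \<star> a"
proof (induction v arbitrary: u)
  case (End V)
  have "trunk_length u > 0"
    using arg_cong[OF End(1), of trunk_length] assms by (simp add: length_mult)
  then obtain U x m where u: "u = Step U x m" by (cases u) auto
  then obtain B where b: "b = Step B x (m \<star> a)" using End by (cases b) auto
  have le: "dia x (first_theory (m \<star> a)) \<subseteq> B" using End b by simp
  moreover have "dia x (first_theory m) \<subseteq> dia x (first_theory (m \<star> a))"
    by (rule dia_mono[OF first_theory_mult_mono])
  ultimately have "admissible X (Step B x m)" using End b u by auto
  moreover have "b = Step B x m \<star> a" using le b by auto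
  ultimately show ?case by blast
next
  case (Step V x n)
  have "trunk_length u > 0"
    using arg_cong[OF Step.prems(1), of trunk_length] assms by (simp add: length_mult)
  then obtain U y m where "u = Step U y m" by (cases u) auto
  then show ?case using Step by auto
qed

text \<open>The equation makes \<open>a\<close> and \<open>b\<close> agree except in their first theories, and the theory of \<open>u \<star> a = v \<star> b\<close> at
the vertex where \<open>a\<close> and \<open>b\<close> start contains both of these.\<close>

lemma equal_length_left_multiples:
  assumes "trunk_length a = trunk_length b"
  shows "u \<star> a = v \<star> b \<Longrightarrow>
    End (first_theory b) \<star> a = End (first_theory a) \<star> b \<and>
    u \<star> a = u \<star> (End (first_theory b) \<star> a)"
proof (induction u arbitrary: v)
  case (End U)
  have "trunk_length v = 0"
    using arg_cong[OF End, of trunk_length] assms by (simp add: length_mult)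
  then obtain V where "v = End V" by (cases v) auto
  then show ?case using End by (cases a; cases b) auto
next
  case (Step U x m)
  have "trunk_length v > 0"
    using arg_cong[OF Step.prems, of trunk_length] assms by (simp add: length_mult)
  then obtain V y n where v: "v = Step V y n" by (cases v) auto
  then have "m \<star> a = n \<star> b" using Step.prems by simp
  from Step.IH[OF this] show ?case by (simp del: tmult.simps(1) add: tmult.simps(2))
qed

lemma generates_meet_opposite_aux:
  assumes ab: "admissible X a" "admissible X b" "admissible X u" "admissible X v" "u \<star> a = v \<star> b"
    and len: "trunk_length a \<le> trunk_length b"
  shows "\<exists>p q. generates_meet (opposite_monoid (trunk_monoid X)) a b p q"
proof (cases "trunk_length a = trunk_length b")
  case True
  note eq = equal_length_left_multiples[OF True]
  let ?p = "End (first_theory b)" and ?q = "End (first_theory a)"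
  have "generates_meet (opposite_monoid (trunk_monoid X)) a b ?p ?q"
  proof (rule generates_meetI)
    show "a \<otimes>\<^bsub>opposite_monoid (trunk_monoid X)\<^esub> ?p = b \<otimes>\<^bsub>opposite_monoid (trunk_monoid X)\<^esub> ?q"
      using eq[OF ab(5)] by (simp del: tmult.simps)
    fix u v assume "u \<in> carrier (opposite_monoid (trunk_monoid X))"
      "a \<otimes>\<^bsub>opposite_monoid (trunk_monoid X)\<^esub> u = b \<otimes>\<^bsub>opposite_monoid (trunk_monoid X)\<^esub> v"
    then show "\<exists>s\<in>carrier (opposite_monoid (trunk_monoid X)).
        a \<otimes>\<^bsub>opposite_monoid (trunk_monoid X)\<^esub> u =
        a \<otimes>\<^bsub>opposite_monoid (trunk_monoid X)\<^esub> ?p \<otimes>\<^bsub>opposite_monoid (trunk_monoid X)\<^esub> s"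
      using eq[of u v] by (intro bexI[of _ u]) (simp_all del: tmult.simps)
  qed (use ab fin_gen_first in auto)
  then show ?thesis by blast
next
  case False
  then obtain w where w: "admissible X w" "b = w \<star> a"
    using shorter_is_left_divisor[of a b u v X] ab len by auto
  \<comment> \<open>All multiples of \<open>b\<close> are multiples of \<open>a\<close>.\<close>
  have "generates_meet (opposite_monoid (trunk_monoid X)) a b w (End {})"
  proof (rule generates_meetI)
    fix u v assume "v \<in> carrier (opposite_monoid (trunk_monoid X))"
      "a \<otimes>\<^bsub>opposite_monoid (trunk_monoid X)\<^esub> u = b \<otimes>\<^bsub>opposite_monoid (trunk_monoid X)\<^esub> v"
    then show "\<exists>s\<in>carrier (opposite_monoid (trunk_monoid X)).
        a \<otimes>\<^bsub>opposite_monoid (trunk_monoid X)\<^esub> u =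
        a \<otimes>\<^bsub>opposite_monoid (trunk_monoid X)\<^esub> w \<otimes>\<^bsub>opposite_monoid (trunk_monoid X)\<^esub> s"
      using w(2) by (intro bexI[of _ v]) (simp_all del: tmult.simps)
  qed (use w in \<open>simp_all add: enlarge_id\<close>)
  then show ?thesis by blast
qed

lemma meets_principal_opposite_trunk: "meets_principal (opposite_monoid (trunk_monoid X))"
  unfolding meets_principal_def
proof (intro ballI impI)
  fix a b assume ab: "a \<in> carrier (opposite_monoid (trunk_monoid X))"
    "b \<in> carrier (opposite_monoid (trunk_monoid X))"
    "\<exists>u\<in>carrier (opposite_monoid (trunk_monoid X)).
      \<exists>v\<in>carrier (opposite_monoid (trunk_monoid X)).
        a \<otimes>\<^bsub>opposite_monoid (trunk_monoid X)\<^esub> u = b \<otimes>\<^bsub>opposite_monoid (trunk_monoid X)\<^esub> v"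
  then obtain u v where "admissible X u" "admissible X v" "u \<star> a = v \<star> b" by auto
  then show "\<exists>p q. generates_meet (opposite_monoid (trunk_monoid X)) a b p q"
    using generates_meet_opposite_aux[of X a b u v] generates_meet_opposite_aux[of X b a v u] ab
      generates_meet_sym[of "opposite_monoid (trunk_monoid X)" b a]
    by (cases "trunk_length a \<le> trunk_length b") (fastforce, force)
qed

section \<open>Left Ehresmann trees are arborescences\<close>

text \<open>This description of left Ehresmann trees replaces the absence of undirected cycles by the
uniqueness of parents and directed acyclicity, which can be verified for products and images.\<close>

definition arborescence :: "'x set \<Rightarrow> ('v, 'x) xtree \<Rightarrow> bool" where
  "arborescence X T \<longleftrightarrow> finite (tverts T) \<and> finite (tedges T) \<and>
     tedges T \<subseteq> tverts T \<times> X \<times> tverts T \<and> tstart T \<in> tverts T \<and> tend T \<in> tverts T \<and>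
     (\<forall>v\<in>tverts T. (tstart T, v) \<in> (dstep T)\<^sup>*) \<and>
     (\<forall>u x u' x' v. (u, x, v) \<in> tedges T \<longrightarrow> (u', x', v) \<in> tedges T \<longrightarrow> u = u' \<and> x = x') \<and>
     acyclic (dstep T)"

lemma arborescenceD:
  assumes "arborescence X T"
  shows "finite (tverts T)" "finite (tedges T)" "tstart T \<in> tverts T" "tend T \<in> tverts T"
    "acyclic (dstep T)" "tedges T \<subseteq> tverts T \<times> X \<times> tverts T"
    "(u, x, v) \<in> tedges T \<Longrightarrow> u \<in> tverts T" "(u, x, v) \<in> tedges T \<Longrightarrow> x \<in> X"
    "(u, x, v) \<in> tedges T \<Longrightarrow> v \<in> tverts T"
    "v \<in> tverts T \<Longrightarrow> (tstart T, v) \<in> (dstep T)\<^sup>*"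
    "(u, x, v) \<in> tedges T \<Longrightarrow> (u', x', v) \<in> tedges T \<Longrightarrow> u = u' \<and> x = x'"
  using assms unfolding arborescence_def by blast+

lemma arborescenceI:
  assumes "finite (tverts T)" "finite (tedges T)" "tedges T \<subseteq> tverts T \<times> X \<times> tverts T"
    "tstart T \<in> tverts T" "tend T \<in> tverts T"
    "\<And>v. v \<in> tverts T \<Longrightarrow> (tstart T, v) \<in> (dstep T)\<^sup>*"
    "\<And>u x u' x' v. (u, x, v) \<in> tedges T \<Longrightarrow> (u', x', v) \<in> tedges T \<Longrightarrow> u = u' \<and> x = x'"
    "acyclic (dstep T)"
  shows "arborescence X T"
  unfolding arborescence_def using assms(1-6,8)
  by (intro conjI ballI) (assumption | simp | intro allI impI, rule assms(7))+

lemma dstepI: "(u, x, v) \<in> tedges T \<Longrightarrow> (u, v) \<in> dstep T"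
  by (auto simp: dstep_def)

lemma simple_path:
  assumes "(a, b) \<in> R\<^sup>*"
  shows "\<exists>vs. vs \<noteq> [] \<and> hd vs = a \<and> last vs = b \<and> distinct vs \<and> successively (\<lambda>x y. (x, y) \<in> R) vs"
  using assms
proof (induction rule: converse_rtrancl_induct)
  case base
  show ?case by (rule exI[of _ "[b]"]) simp
next
  case (step a c)
  then obtain vs where vs: "vs \<noteq> []" "hd vs = c" "last vs = b" "distinct vs"
    "successively (\<lambda>x y. (x, y) \<in> R) vs" by blast
  show ?case
  proof (cases "a \<in> set vs")
    case True
    then obtain xs ys where "vs = xs @ a # ys" by (auto dest: split_list)
    then show ?thesis using vs by (intro exI[of _ "a # ys"]) (auto simp: successively_append_iff)
  next
    case False
    then show ?thesis using vs step(1) by (intro exI[of _ "a # vs"]) (auto simp: successively_Cons)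
  qed
qed

text \<open>Adjacency in the underlying undirected graph after removal of the edge \<open>e\<close>.\<close>

definition avoiding :: "('v, 'x) xtree \<Rightarrow> 'v \<times> 'x \<times> 'v \<Rightarrow> ('v \<times> 'v) set" where
  "avoiding T e = {(a, b). \<exists>e'\<in>tedges T - {e}. joins e' a b}"

lemma sym_avoiding: "sym (avoiding T e)"
  unfolding avoiding_def joins_def sym_def by blast

lemma dstep_avoiding: "(a, b) \<in> dstep T \<Longrightarrow> (a, b) \<in> avoiding T (u, x, v) \<or> a = u \<and> b = v"
  unfolding avoiding_def joins_def dstep_def by blast

text \<open>Otherwise a simple path around the edge, together with the edge, is an undirected cycle.\<close>

lemma edge_is_bridge:
  assumes nocyc: "\<nexists>vs es. undirected_cycle T vs es" and e: "(u, x, v) \<in> tedges T"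
  shows "(v, u) \<notin> (avoiding T (u, x, v))\<^sup>*"
proof
  assume "(v, u) \<in> (avoiding T (u, x, v))\<^sup>*"
  then obtain vs where vs: "vs \<noteq> []" "hd vs = v" "last vs = u" "distinct vs"
    and succ: "successively (\<lambda>a b. (a, b) \<in> avoiding T (u, x, v)) vs"
    using simple_path by metis
  define n where "n = length vs - 1"
  have n: "length vs = Suc n" using vs(1) by (simp add: n_def)
  have ends: "vs ! 0 = v" "vs ! n = u"
    using vs n by (auto simp: hd_conv_nth last_conv_nth)
  have "\<forall>i. \<exists>e'. i < n \<longrightarrow> e' \<in> tedges T - {(u, x, v)} \<and> joins e' (vs ! i) (vs ! Suc i)"
    using succ n unfolding successively_conv_nth avoiding_def by fastforce
  then obtain h where h: "\<And>i. i < n \<Longrightarrow> h i \<in> tedges T - {(u, x, v)}"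
    "\<And>i. i < n \<Longrightarrow> joins (h i) (vs ! i) (vs ! Suc i)" by metis
  have inj: "i = j" if "i < n" "j < n" "h i = h j" for i j
  proof -
    have "{vs ! i, vs ! Suc i} = {vs ! j, vs ! Suc j}"
      using h(2)[OF that(1)] h(2)[OF that(2)] that(3) unfolding joins_def by auto
    then show ?thesis
      using that n vs(4) by (auto simp: doubleton_eq_iff nth_eq_iff_index_eq)
  qed
  \<comment> \<open>The edge from \<open>u\<close> back to \<open>v\<close> closes the path.\<close>
  let ?es = "map h [0..<n] @ [(u, x, v)]"
  have "undirected_cycle T vs ?es"
    unfolding undirected_cycle_def
  proof (intro conjI allI impI)
    have "inj_on h {0..<n}" using inj by (auto simp: inj_on_def)
    moreover have "(u, x, v) \<notin> h ` {0..<n}" using h(1) by force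
    ultimately show "distinct ?es" by (simp add: distinct_map)
    show "set ?es \<subseteq> tedges T" using h(1) e by auto
    fix i assume i: "i < length ?es"
    show "joins (?es ! i) (vs ! i) (vs ! (Suc i mod length ?es))"
    proof (cases "i = n")
      case True
      then show ?thesis using ends by (auto simp: nth_append joins_def)
    next
      case False
      then show ?thesis using i h(2)[of i] by (simp add: nth_append)
    qed
  qed (use vs(4) n in auto)
  then show False using nocyc by blast
qed

text \<open>A cycle has as many edges as vertices. Distinct edges end in distinct vertices, so every vertex
of the cycle is the head of an edge of the cycle. Hence there is no first vertex on the cycle
with respect to the wellfounded relation given by the edges.\<close>

lemma no_undirected_cycle_arborescence:
  fixes T :: "('v, 'x) xtree"
  assumes "arborescence X T" shows "\<not> undirected_cycle T vs es"
proof
  assume cyc: "undirected_cycle T vs es"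
  have unique: "u = u' \<and> x = x'" if "(u, x, v) \<in> tedges T" "(u', x', v) \<in> tedges T" for u x u' x' v
    using assms that unfolding arborescence_def by blast
  have "tedges T \<subseteq> tverts T \<times> X \<times> tverts T" "finite (tverts T)" "acyclic (dstep T)"
    using assms by (auto simp: arborescence_def)
  then have "dstep T \<subseteq> tverts T \<times> tverts T" "finite (tverts T \<times> tverts T)"
    by (auto simp: dstep_def)
  then have wf: "wf (dstep T)"
    using finite_acyclic_wf[OF finite_subset] \<open>acyclic (dstep T)\<close> by blast
  define h :: "'v \<times> 'x \<times> 'v \<Rightarrow> 'v" where "h e = snd (snd e)" for e
  have es: "set es \<subseteq> tedges T" using cyc by (simp add: undirected_cycle_def)
  have ends: "fst e \<in> set vs \<and> h e \<in> set vs" if e: "e \<in> set es" for e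
  proof -
    obtain i where i: "i < length es" "es ! i = e" using e by (auto simp: in_set_conv_nth)
    then have "joins e (vs ! i) (vs ! (Suc i mod length es))" "length vs = length es"
      using cyc by (auto simp: undirected_cycle_def)
    moreover have "Suc i mod length es < length es" using i by (intro mod_less_divisor) auto
    ultimately show ?thesis using i by (auto simp: joins_def h_def)
  qed
  have "inj_on h (set es)"
  proof (rule inj_onI)
    fix e e' assume "e \<in> set es" "e' \<in> set es" "h e = h e'"
    moreover obtain u x v u' x' v' where "e = (u, x, v)" "e' = (u', x', v')"
      by (cases e, cases e') auto
    ultimately show "e = e'" using es unique[of u x v u' x'] by (auto simp: h_def)
  qed
  moreover have "card (set es) = card (set vs)"
    using cyc by (simp add: undirected_cycle_def distinct_card)
  ultimately have heads: "h ` set es = set vs"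
    using ends by (intro card_subset_eq) (auto simp: card_image)
  have pred: "\<exists>u\<in>set vs. (u, v) \<in> dstep T" if v: "v \<in> set vs" for v
  proof -
    obtain e where e: "e \<in> set es" "v = h e" using v heads by blast
    then have "(fst e, v) \<in> dstep T" using es by (auto simp: h_def intro!: dstepI[of _ "fst (snd e)"])
    then show ?thesis using ends[OF e(1)] by blast
  qed
  obtain v where "v \<in> set vs" using cyc by (cases vs) (auto simp: undirected_cycle_def)
  then obtain w where "w \<in> set vs" "\<forall>u. (u, w) \<in> dstep T \<longrightarrow> u \<notin> set vs"
    using wf unfolding wf_eq_minimal by blast
  then show False using pred by blast
qed

lemma arborescence_imp_xtree:
  assumes "arborescence X T" shows "is_xtree X T" "left_ehresmann T"
proof -
  have reach: "(tstart T, v) \<in> (dstep T)\<^sup>*" if "v \<in> tverts T" for v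
    using assms that by (auto simp: arborescence_def)
  then show "left_ehresmann T" by (simp add: left_ehresmann_def)
  have "(u, v) \<in> (dstep T \<union> (dstep T)\<inverse>)\<^sup>*" if "u \<in> tverts T" "v \<in> tverts T" for u v
  proof -
    have "(u, tstart T) \<in> ((dstep T)\<inverse>)\<^sup>*" using reach[OF that(1)] by (simp add: rtrancl_converse)
    then have "(u, tstart T) \<in> (dstep T \<union> (dstep T)\<inverse>)\<^sup>*" by (rule in_rtrancl_UnI[OF disjI2])
    moreover have "(tstart T, v) \<in> (dstep T \<union> (dstep T)\<inverse>)\<^sup>*"
      using reach[OF that(2)] by (rule in_rtrancl_UnI[OF disjI1])
    ultimately show ?thesis by (rule rtrancl_trans)
  qed
  then show "is_xtree X T"
    using assms no_undirected_cycle_arborescence[OF assms]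
    by (auto simp: is_xtree_def arborescence_def underlying_tree_def)
qed

text \<open>If a directed path returns from \<open>v\<close> to \<open>u\<close>, where \<open>(u, x, v)\<close> is an edge, then it also does so without using
this edge, because each use leads back to \<open>v\<close>. But the edge is a bridge.\<close>

lemma acyclic_xtree:
  assumes nocyc: "\<nexists>vs es. undirected_cycle T vs es"
  shows "acyclic (dstep T)"
proof (rule acyclicI, intro allI notI)
  fix u assume "(u, u) \<in> (dstep T)\<^sup>+"
  then obtain v where "(u, v) \<in> dstep T" and vu: "(v, u) \<in> (dstep T)\<^sup>*" by (meson tranclD)
  then obtain x where e: "(u, x, v) \<in> tedges T" by (auto simp: dstep_def)
  have "(v, z) \<in> (avoiding T (u, x, v))\<^sup>*" if "(v, z) \<in> (dstep T)\<^sup>*" for z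
    using that
  proof induction
    case (step y z)
    then show ?case using dstep_avoiding[of y z T u x v] by (auto intro: rtrancl_into_rtrancl)
  qed simp
  then show False using edge_is_bridge[OF nocyc e] vu by blast
qed

text \<open>For uniqueness of the parent, suppose that two edges end in \<open>v\<close>, with sources \<open>u\<close> and \<open>u'\<close>. Directed
paths from the start vertex to \<open>u\<close> and \<open>u'\<close> avoid \<open>v\<close> by acyclicity, and so avoid the first edge. Then
the second edge connects \<open>v\<close> to \<open>u\<close> around the first edge, which is a bridge.\<close>

lemma xtree_imp_arborescence:
  assumes "is_xtree X T" "left_ehresmann T" shows "arborescence X T"
proof -
  have nocyc: "\<nexists>vs es. undirected_cycle T vs es"
    using assms(1) by (auto simp: is_xtree_def underlying_tree_def)
  have acyc: "acyclic (dstep T)" using acyclic_xtree[OF nocyc] .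
  have edges: "tedges T \<subseteq> tverts T \<times> X \<times> tverts T" using assms(1) by (simp add: is_xtree_def)
  have "u = u' \<and> x = x'" if e: "(u, x, v) \<in> tedges T" "(u', x', v) \<in> tedges T" for u x u' x' v
  proof (rule ccontr)
    assume ne: "\<not> ?thesis"
    let ?R = "avoiding T (u, x, v)"
    have "(tstart T, z) \<in> ?R\<^sup>* \<or> (v, z) \<in> (dstep T)\<^sup>*" if "(tstart T, z) \<in> (dstep T)\<^sup>*" for z
      using that
    proof induction
      case (step y z)
      then show ?case
        using dstep_avoiding[of y z T u x v] by (auto intro: rtrancl_into_rtrancl)
    qed simp
    moreover have "(tstart T, u) \<in> (dstep T)\<^sup>*" "(tstart T, u') \<in> (dstep T)\<^sup>*"
      using assms(2) edges e by (auto simp: left_ehresmann_def)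
    moreover have "(v, u) \<notin> (dstep T)\<^sup>*" "(v, u') \<notin> (dstep T)\<^sup>*"
      using acyc dstepI[OF e(1)] dstepI[OF e(2)]
      unfolding acyclic_def by (meson rtrancl_into_trancl1)+
    ultimately have "(tstart T, u) \<in> ?R\<^sup>*" "(tstart T, u') \<in> ?R\<^sup>*" by blast+
    moreover have "(u', v) \<in> ?R" using e ne by (auto simp: avoiding_def joins_def)
    ultimately have "(tstart T, u) \<in> ?R\<^sup>*" "(tstart T, v) \<in> ?R\<^sup>*"
      by (auto intro: rtrancl_into_rtrancl)
    then have "(v, u) \<in> ?R\<^sup>*"
      using sym_rtrancl[OF sym_avoiding] by (meson rtrancl_trans symD)
    then show False using edge_is_bridge[OF nocyc e(1)] by blast
  qed
  then show ?thesis
    using assms acyc unfolding arborescence_def is_xtree_def left_ehresmann_def by blast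
qed

section \<open>The theory of a vertex and the trunk of a tree\<close>

primrec holds :: "('v, 'x) xtree \<Rightarrow> 'x branches \<Rightarrow> 'v \<Rightarrow> bool" where
  "holds T Leaf = (\<lambda>v. True)"
| "holds T (Br x t s) = (\<lambda>v. (\<exists>v'. (v, x, v') \<in> tedges T \<and> holds T t v') \<and> holds T s v)"

text \<open>The explicit recursion \<open>holds\<close> serves to define this set and to prove facts by induction over the
trees in it; \<open>mem_theory_at\<close> is the intrinsic characterisation.\<close>

definition theory_at :: "('v, 'x) xtree \<Rightarrow> 'v \<Rightarrow> ('x \<times> 'x branches) set" where
  "theory_at T v = {(x, t). \<exists>v'. (v, x, v') \<in> tedges T \<and> holds T t v'}"

lemma holds_iff: "holds T t v \<longleftrightarrow> kids t \<subseteq> theory_at T v"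
  by (induction t) (auto simp: theory_at_def)

lemma mem_theory_at:
  "(x, t) \<in> theory_at T v \<longleftrightarrow> (\<exists>v'. (v, x, v') \<in> tedges T \<and> kids t \<subseteq> theory_at T v')"
  by (subst theory_at_def) (simp add: holds_iff)

lemma dia_subset_theory_at:
  "(v, x, v') \<in> tedges T \<Longrightarrow> dia x (theory_at T v') \<subseteq> theory_at T v"
  by (auto simp: mem_theory_at)

lemma fin_gen_UN_dia:
  assumes "finite K" "\<And>x v. (x, v) \<in> K \<Longrightarrow> x \<in> X \<and> fin_gen X (f v)"
  shows "fin_gen X (\<Union>(x, v)\<in>K. dia x (f v))"
  using assms by (induction K) (auto intro!: fin_gen_Un fin_gen_dia)

lemma finite_dstep: assumes "arborescence X T" shows "finite (dstep T)"
proof (rule finite_subset)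
  show "dstep T \<subseteq> tverts T \<times> tverts T"
    using assms by (auto simp: arborescence_def dstep_def)
qed (use assms in \<open>simp add: arborescence_def\<close>)

text \<open>The theory of a vertex is generated by the finite subtree below it.\<close>

lemma fin_gen_theory_at:
  assumes "arborescence X T" shows "fin_gen X (theory_at T v)"
proof -
  have "wf ((dstep T)\<inverse>)"
    using assms finite_dstep[OF assms] by (simp add: finite_acyclic_wf_converse arborescence_def)
  then show ?thesis
  proof (induction v)
    case (less v)
    define K where "K = {(x, v'). (v, x, v') \<in> tedges T}"
    have "finite ((\<lambda>e. (fst (snd e), snd (snd e))) ` tedges T)"
      using assms by (simp add: arborescence_def)
    then have "finite K" by (rule finite_subset[rotated]) (force simp: K_def)
    moreover have "x \<in> X \<and> fin_gen X (theory_at T v')" if "(x, v') \<in> K" for x v'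
      using that less dstepI[of v x v' T] assms by (auto simp: K_def arborescence_def)
    ultimately have "fin_gen X (\<Union>(x, v')\<in>K. dia x (theory_at T v'))"
      by (rule fin_gen_UN_dia)
    moreover have "theory_at T v = (\<Union>(x, v')\<in>K. dia x (theory_at T v'))"
      by (auto simp: K_def mem_theory_at)
    ultimately show ?case by simp
  qed
qed

text \<open>The relation is stated for all vertices on the trunk, so that the trunk can be followed from its
end to its start. It is a partial function of the vertex (\<open>trunk_value_unique\<close>).\<close>

inductive trunk_value :: "('v, 'x) xtree \<Rightarrow> 'v \<Rightarrow> 'x trunk \<Rightarrow> bool" for T where
  at_end: "trunk_value T (tend T) (End (theory_at T (tend T)))"
| at_edge: "(v, x, v') \<in> tedges T \<Longrightarrow> trunk_value T v' m \<Longrightarrow>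
    trunk_value T v (Step (theory_at T v) x m)"

inductive_cases trunk_value_EndE: "trunk_value T v (End U)"
inductive_cases trunk_value_StepE: "trunk_value T v (Step U x m)"

lemma first_trunk_value: "trunk_value T v m \<Longrightarrow> first_theory m = theory_at T v"
  by (induction rule: trunk_value.induct) auto

lemma admissible_trunk_value:
  assumes "arborescence X T" "trunk_value T v m" shows "admissible X m"
  using assms(2)
proof induction
  case at_end
  then show ?case using fin_gen_theory_at[OF assms(1)] by simp
next
  case (at_edge v x v' m)
  then show ?case
    using fin_gen_theory_at[OF assms(1)] assms(1) dia_subset_theory_at[OF at_edge(1)]
    by (auto simp: first_trunk_value arborescence_def)
qed

lemma trunk_value_exists: "(v, tend T) \<in> (dstep T)\<^sup>* \<Longrightarrow> \<exists>m. trunk_value T v m"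
proof (induction rule: converse_rtrancl_induct)
  case base
  then show ?case using at_end by blast
next
  case (step u v)
  then show ?case using at_edge by (fastforce simp: dstep_def)
qed

lemma trunk_value_reaches: "trunk_value T v m \<Longrightarrow> (v, tend T) \<in> (dstep T)\<^sup>*"
  by (induction rule: trunk_value.induct) (auto intro: converse_rtrancl_into_rtrancl dstepI)

lemma trunk_value_start:
  assumes "arborescence X T" shows "\<exists>m. trunk_value T (tstart T) m"
  using assms by (intro trunk_value_exists) (simp add: arborescence_def)

text \<open>Going backwards from \<open>c\<close> leaves no choice, as parents are unique.\<close>

lemma ancestors_comparable:
  assumes T: "arborescence X T"
    and "(a, c) \<in> (dstep T)\<^sup>*" "(b, c) \<in> (dstep T)\<^sup>*"
  shows "(a, b) \<in> (dstep T)\<^sup>* \<or> (b, a) \<in> (dstep T)\<^sup>*"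
  using assms(2,3)
proof (induction rule: rtrancl_induct)
  case (step c d)
  show ?case
  proof (cases "b = d")
    case True
    then show ?thesis using step by (auto intro: rtrancl_into_rtrancl)
  next
    case False
    then obtain c' where c': "(b, c') \<in> (dstep T)\<^sup>*" "(c', d) \<in> dstep T"
      using step.prems by (meson rtranclE)
    have "c' = c" using c'(2) step.hyps(2) T unfolding arborescence_def dstep_def by blast
    then show ?thesis using c'(1) step.IH by blast
  qed
qed simp

lemma no_way_back:
  assumes "arborescence X T" "(u, x, v) \<in> tedges T" shows "(v, u) \<notin> (dstep T)\<^sup>*"
  using assms dstepI[OF assms(2)] unfolding arborescence_def acyclic_def
  by (meson rtrancl_into_trancl1)

lemma trunk_child_unique:
  assumes T: "arborescence X T" and e: "(u, x, v) \<in> tedges T" "(u, x', v') \<in> tedges T"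
    and reach: "(v, tend T) \<in> (dstep T)\<^sup>*" "(v', tend T) \<in> (dstep T)\<^sup>*"
  shows "v = v' \<and> x = x'"
proof -
  have *: "w = w'"
    if w: "(u, y, w) \<in> tedges T" "(u, y', w') \<in> tedges T" "(w, w') \<in> (dstep T)\<^sup>*"
    for y w y' w'
  proof (rule ccontr)
    assume "w \<noteq> w'"
    then obtain z where z: "(w, z) \<in> (dstep T)\<^sup>*" "(z, w') \<in> dstep T"
      using w(3) by (meson rtranclE)
    have "z = u" using z(2) w(2) T unfolding arborescence_def dstep_def by blast
    then show False using z(1) no_way_back[OF T w(1)] by blast
  qed
  have "v = v'" using ancestors_comparable[OF T reach] *[OF e] *[OF e(2,1)] by blast
  then show ?thesis using e T unfolding arborescence_def by blast
qed

lemma trunk_value_unique: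
  assumes T: "arborescence X T"
  shows "trunk_value T v m \<Longrightarrow> trunk_value T v n \<Longrightarrow> m = n"
proof (induction arbitrary: n rule: trunk_value.induct)
  case at_end
  have no: "\<not> trunk_value T v' m" if "(tend T, x, v') \<in> tedges T" for x v' m
    using no_way_back[OF T that] trunk_value_reaches[of T v' m] by blast
  from at_end show ?case
  proof (cases rule: trunk_value.cases)
    case (at_edge x v' m)
    then show ?thesis using no by blast
  qed simp
next
  case (at_edge v x v' m)
  note e = at_edge.hyps(1) and m = at_edge.hyps(2) and IH = at_edge.IH
  from at_edge.prems show ?case
  proof (cases rule: trunk_value.cases)
    case at_end
    then show ?thesis using no_way_back[OF T e] trunk_value_reaches[OF m] by blast
  next
    case (at_edge x' v'' m')
    have "v' = v'' \<and> x = x'"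
      using trunk_child_unique[OF T e at_edge(2) trunk_value_reaches[OF m]
        trunk_value_reaches[OF at_edge(3)]] .
    then show ?thesis using at_edge IH by simp
  qed
qed

section \<open>Existence of morphisms\<close>

primrec trunk_le :: "'x trunk \<Rightarrow> 'x trunk \<Rightarrow> bool" where
  "trunk_le (End U) n \<longleftrightarrow> (\<exists>V. n = End V \<and> U \<subseteq> V)"
| "trunk_le (Step U x m) n \<longleftrightarrow> (\<exists>V n'. n = Step V x n' \<and> U \<subseteq> V \<and> trunk_le m n')"

lemma trunk_le_antisym: "trunk_le m n \<Longrightarrow> trunk_le n m \<Longrightarrow> m = n"
proof (induction m arbitrary: n)
  case (End U)
  then show ?case by (cases n) auto
next
  case (Step U x m)
  then obtain V n' where n: "n = Step V x n'" "U \<subseteq> V" "trunk_le m n'" by auto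
  then have "V \<subseteq> U" "trunk_le n' m" using Step.prems(2) by simp_all
  then show ?case using n Step.IH by blast
qed

lemma trunk_le_refl: "trunk_le m m"
  by (induction m) auto

lemma first_trunk_le: "trunk_le m n \<Longrightarrow> first_theory m \<subseteq> first_theory n"
  by (cases m) auto

lemma morphism_edge:
  "xtree_morphism S T f \<Longrightarrow> (u, x, v) \<in> tedges S \<Longrightarrow> (f u, x, f v) \<in> tedges T"
  unfolding xtree_morphism_def edge_map_def by (drule conjunct2, drule conjunct1) (auto simp: image_subset_iff)

lemma theory_at_mono:
  assumes f: "\<And>u x v. (u, x, v) \<in> tedges S \<Longrightarrow> (f u, x, f v) \<in> tedges T"
  shows "theory_at S v \<subseteq> theory_at T (f v)"
proof -
  have "holds S t u \<Longrightarrow> holds T t (f u)" for t u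
    by (induction t arbitrary: u) (auto dest: f)
  then show ?thesis by (auto simp: theory_at_def dest: f)
qed

lemma trunk_value_morphism:
  assumes f: "xtree_morphism S T f"
  shows "trunk_value S v m \<Longrightarrow> \<exists>n. trunk_value T (f v) n \<and> trunk_le m n"
proof (induction rule: trunk_value.induct)
  case at_end
  have "f (tend S) = tend T" using f by (simp add: xtree_morphism_def)
  then show ?case using trunk_value.at_end[of T] theory_at_mono[of S f T "tend S", OF morphism_edge[OF f]] by auto
next
  case (at_edge v x v' m)
  then obtain n where n: "trunk_value T (f v') n" "trunk_le m n" by blast
  then have "trunk_value T (f v) (Step (theory_at T (f v)) x n)"
    using trunk_value.at_edge[OF morphism_edge[OF f at_edge(1)]] by blast
  then show ?case using n(2) theory_at_mono[of S f T v, OF morphism_edge[OF f]] by auto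
qed

text \<open>As every vertex has at most one parent, the images of the vertices can be chosen one after the
other, starting with the start vertex. Instead of a recursion along the tree, take a largest set
of vertices on which a map with all required properties exists; it is closed under passing to
children.\<close>

lemma simulation_lifts:
  assumes S: "arborescence X S" and T: "arborescence Y T"
    and start: "(tstart S, tstart T) \<in> G"
    and step: "\<And>u u' x v. (u, u') \<in> G \<Longrightarrow> (u, x, v) \<in> tedges S \<Longrightarrow>
      \<exists>v'. (u', x, v') \<in> tedges T \<and> (v, v') \<in> G"
  shows "\<exists>f. f (tstart S) = tstart T \<and> f ` tverts S \<subseteq> tverts T \<and>
    edge_map f ` tedges S \<subseteq> tedges T \<and> (\<forall>v\<in>tverts S. (v, f v) \<in> G)"
proof -
  have edgesS: "u \<in> tverts S" "v \<in> tverts S" if "(u, x, v) \<in> tedges S" for u x v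
    by (rule arborescenceD(7)[OF S that], rule arborescenceD(9)[OF S that])
  have edgesT: "u \<in> tverts T" "v \<in> tverts T" if "(u, x, v) \<in> tedges T" for u x v
    by (rule arborescenceD(7)[OF T that], rule arborescenceD(9)[OF T that])
  define good where "good A \<longleftrightarrow> A \<subseteq> tverts S \<and> tstart S \<in> A \<and>
    (\<exists>f. f (tstart S) = tstart T \<and> f ` A \<subseteq> tverts T \<and> (\<forall>v\<in>A. (v, f v) \<in> G) \<and>
      (\<forall>u x v. (u, x, v) \<in> tedges S \<longrightarrow> v \<in> A \<longrightarrow> u \<in> A \<and> (f u, x, f v) \<in> tedges T))" for A
  have no_edge: "(u, x, tstart S) \<notin> tedges S" for u x
  proof
    assume e: "(u, x, tstart S) \<in> tedges S"
    have "(tstart S, u) \<in> (dstep S)\<^sup>*" using arborescenceD(10)[OF S edgesS(1)[OF e]] .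
    then show False using no_way_back[OF S e] by blast
  qed
  have "tstart T \<in> tverts T" "tstart S \<in> tverts S" using arborescenceD S T by blast+
  then have "good {tstart S}"
    using start no_edge unfolding good_def
    by (intro conjI exI[of _ "\<lambda>_. tstart T"]) (simp_all add: image_subset_iff)
  moreover have "\<forall>A. good A \<longrightarrow> card A < Suc (card (tverts S))"
  proof (intro allI impI)
    fix A assume "good A"
    then have "A \<subseteq> tverts S" by (simp add: good_def)
    then show "card A < Suc (card (tverts S))"
      using arborescenceD(1)[OF S] by (simp add: card_mono less_Suc_eq_le)
  qed
  ultimately have "\<exists>A. good A \<and> (\<forall>B. good B \<longrightarrow> card B \<le> card A)"
    by (rule ex_has_greatest_nat[of good "{tstart S}" card])
  then obtain A where A: "good A" and max: "\<And>B. good B \<Longrightarrow> card B \<le> card A" by blast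
  from A obtain f where f: "f (tstart S) = tstart T" "f ` A \<subseteq> tverts T"
      "\<And>v. v \<in> A \<Longrightarrow> (v, f v) \<in> G"
      "\<And>u x v. (u, x, v) \<in> tedges S \<Longrightarrow> v \<in> A \<Longrightarrow> u \<in> A \<and> (f u, x, f v) \<in> tedges T"
    unfolding good_def by blast
  have As: "A \<subseteq> tverts S" "tstart S \<in> A" using A by (auto simp: good_def)
  have finA: "finite A" using As(1) arborescenceD(1)[OF S] by (rule finite_subset)
  have closed: "v \<in> A" if e: "(u, x, v) \<in> tedges S" and u: "u \<in> A" for u x v
  proof (rule ccontr)
    assume v: "v \<notin> A"
    obtain v' where v': "(f u, x, v') \<in> tedges T" "(v, v') \<in> G" using step[OF f(3)[OF u] e] by blast
    let ?f = "f(v := v')"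
    have "?f (tstart S) = tstart T" using As v f(1) by auto
    moreover have "?f ` insert v A \<subseteq> tverts T" using f(2) edgesT[OF v'(1)] by auto
    moreover have "\<forall>w\<in>insert v A. (w, ?f w) \<in> G" using f(3) v'(2) by auto
    moreover have "a \<in> insert v A \<and> (?f a, y, ?f w) \<in> tedges T"
      if "(a, y, w) \<in> tedges S" "w \<in> insert v A" for a y w
    proof (cases "w = v")
      case True
      then have "a = u" "y = x" using that(1) e arborescenceD(11)[OF S] by blast+
      then show ?thesis using True u v v' by auto
    next
      case False
      then show ?thesis using that f(4)[OF that(1)] v by auto
    qed
    ultimately have "good (insert v A)"
      using As edgesS[OF e] unfolding good_def by (intro conjI exI[of _ ?f]) simp_all
    from max[OF this] show False using finA v by simp
  qed
  have "v \<in> A" if "(tstart S, v) \<in> (dstep S)\<^sup>*" for v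
    using that by induction (auto simp: As dstep_def intro: closed)
  then have "A = tverts S" using As(1) arborescenceD(10)[OF S] by blast
  moreover from this have "edge_map f ` tedges S \<subseteq> tedges T"
    using f(4) edgesS by (auto simp: edge_map_def)
  ultimately show ?thesis using f(1-3) by (intro exI[of _ f] conjI ballI) simp_all
qed

text \<open>Relate vertices \<open>v\<close> and \<open>v'\<close> if the theory of \<open>v\<close> is contained in that of \<open>v'\<close> and, in case \<open>v\<close> lies on the
trunk, so does \<open>v'\<close> and the final parts of the trunks are comparable. This is a simulation: along
the trunk there is a prescribed next vertex, and off the trunk the edge to a
child of \<open>v\<close>, followed by a tree that generates the theory of this child, belongs to the theory of \<open>v\<close>
and hence to that of \<open>v'\<close>, which yields the child of \<open>v'\<close>.\<close>

lemma morphism_of_trunk_le: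
  assumes S: "arborescence X S" and T: "arborescence Y T"
    and m: "trunk_value S (tstart S) m" and n: "trunk_value T (tstart T) n" and le: "trunk_le m n"
  shows "\<exists>f. xtree_morphism S T f"
proof -
  define G where "G = {(v, v'). theory_at S v \<subseteq> theory_at T v' \<and>
    (\<forall>m. trunk_value S v m \<longrightarrow> (\<exists>n. trunk_value T v' n \<and> trunk_le m n))}"
  have GI: "(v, v') \<in> G" if "trunk_value S v m" "trunk_value T v' n" "trunk_le m n" for v v' m n
  proof -
    have "theory_at S v \<subseteq> theory_at T v'"
      using first_trunk_le[OF that(3)] first_trunk_value[OF that(1)] first_trunk_value[OF that(2)] by simp
    moreover have "\<exists>n. trunk_value T v' n \<and> trunk_le m' n" if m': "trunk_value S v m'" for m'
      using trunk_value_unique[OF S m' \<open>trunk_value S v m\<close>] \<open>trunk_value T v' n\<close> \<open>trunk_le m n\<close> by blast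
    ultimately show ?thesis by (simp add: G_def)
  qed
  have "\<exists>f. f (tstart S) = tstart T \<and> f ` tverts S \<subseteq> tverts T \<and>
    edge_map f ` tedges S \<subseteq> tedges T \<and> (\<forall>v\<in>tverts S. (v, f v) \<in> G)"
  proof (rule simulation_lifts[OF S T])
    show "(tstart S, tstart T) \<in> G" using GI[OF m n le] .
    fix u u' x v assume G: "(u, u') \<in> G" and e: "(u, x, v) \<in> tedges S"
    show "\<exists>v'. (u', x, v') \<in> tedges T \<and> (v, v') \<in> G"
    proof (cases "\<exists>m. trunk_value S v m")
      case True
      then obtain m where m: "trunk_value S v m" by blast
      then have "trunk_value S u (Step (theory_at S u) x m)" using e by (rule at_edge[rotated])
      then obtain N where "trunk_value T u' N" "trunk_le (Step (theory_at S u) x m) N"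
        using G unfolding G_def by blast
      then obtain V n where n: "trunk_value T u' (Step V x n)" "trunk_le m n" by auto
      from n(1) obtain v' where "(u', x, v') \<in> tedges T" "trunk_value T v' n"
        by (rule trunk_value_StepE)
      then show ?thesis using GI[OF m] n(2) by blast
    next
      case False
      \<comment> \<open>Up to morphisms in both directions, \<open>t\<close> is the subtree below \<open>v\<close>.\<close>
      obtain t where t: "theory_at S v = down t"
        using fin_gen_theory_at[OF S, of v] by (rule fin_genE)
      have "(x, t) \<in> theory_at S u" using e t kids_subset_down by (auto simp: mem_theory_at)
      then have "(x, t) \<in> theory_at T u'" using G by (auto simp: G_def)
      then obtain v' where v': "(u', x, v') \<in> tedges T" "kids t \<subseteq> theory_at T v'"
        by (auto simp: mem_theory_at)
      then have "theory_at S v \<subseteq> theory_at T v'"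
        using t down_subset_iff[OF fin_gen_theory_at[OF T]] by metis
      then show ?thesis using v' False by (auto simp: G_def)
    qed
  qed
  then obtain f where f: "f (tstart S) = tstart T" "f ` tverts S \<subseteq> tverts T"
    "edge_map f ` tedges S \<subseteq> tedges T" "\<forall>v\<in>tverts S. (v, f v) \<in> G"
    by (elim exE conjE)
  have "(tend S, f (tend S)) \<in> G" using f(4) arborescenceD(4)[OF S] by (rule bspec)
  then obtain N where "trunk_value T (f (tend S)) N" "trunk_le (End (theory_at S (tend S))) N"
    using at_end[of S] unfolding G_def by blast
  then obtain V where "trunk_value T (f (tend S)) (End V)" by auto
  then have "f (tend S) = tend T" by (rule trunk_value_EndE)
  then have "xtree_morphism S T f" using f(1-3) unfolding xtree_morphism_def by (intro conjI)
  then show ?thesis by blast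
qed

text \<open>The invariant that classifies trees up to morphisms in both directions.\<close>

definition tree_value :: "('v, 'x) xtree \<Rightarrow> 'x trunk \<Rightarrow> bool" where
  "tree_value T m \<longleftrightarrow> trunk_value T (tstart T) m"

lemma tree_value_exists: "arborescence X T \<Longrightarrow> \<exists>m. tree_value T m"
  unfolding tree_value_def by (rule trunk_value_start)

lemma tree_value_unique: "arborescence X T \<Longrightarrow> tree_value T m \<Longrightarrow> tree_value T n \<Longrightarrow> m = n"
  unfolding tree_value_def by (rule trunk_value_unique)

lemma admissible_tree_value: "arborescence X T \<Longrightarrow> tree_value T m \<Longrightarrow> admissible X m"
  unfolding tree_value_def by (rule admissible_trunk_value)

lemma tree_value_le:
  assumes f: "xtree_morphism S T f" and m: "tree_value S m"
  shows "\<exists>n. tree_value T n \<and> trunk_le m n"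
  using trunk_value_morphism[OF f m[unfolded tree_value_def]] f
  by (simp add: tree_value_def xtree_morphism_def)

lemma tree_value_eqI:
  assumes S: "arborescence X S" and f: "xtree_morphism S T f" and g: "xtree_morphism T S g"
    and m: "tree_value S m"
  shows "tree_value T m"
proof -
  obtain n where n: "tree_value T n" "trunk_le m n" using tree_value_le[OF f m] by blast
  obtain m' where m': "tree_value S m'" "trunk_le n m'" using tree_value_le[OF g n(1)] by blast
  have "m' = m" using tree_value_unique[OF S m'(1) m] .
  then have "n = m" using n(2) m'(2) trunk_le_antisym by blast
  then show ?thesis using n(1) by simp
qed

lemma morphism_if_same_value:
  assumes "arborescence X S" "arborescence Y T" "tree_value S m" "tree_value T m"
  shows "\<exists>f. xtree_morphism S T f"
  using morphism_of_trunk_le[OF assms(1,2) _ _ trunk_le_refl] assms(3,4)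
  unfolding tree_value_def by blast

section \<open>Images of trees\<close>

lemma xtree_image_simps [simp]:
  "tverts (xtree_image f T) = f ` tverts T" "tedges (xtree_image f T) = edge_map f ` tedges T"
  "tstart (xtree_image f T) = f (tstart T)" "tend (xtree_image f T) = f (tend T)"
  by (simp_all add: xtree_image_def)

lemma morphism_onto_image: "xtree_morphism T (xtree_image f T) f"
  by (simp add: xtree_morphism_def)

lemma edge_map_comp: "edge_map g (edge_map f e) = edge_map (g \<circ> f) e"
  by (cases e) (simp add: edge_map_def)

lemma edge_map_simp [simp]: "edge_map f (u, x, v) = (f u, x, f v)"
  by (simp add: edge_map_def)

lemma edge_map_id [simp]: "edge_map id = id"
  by (auto simp: edge_map_def)

lemma morphism_id: "xtree_morphism T T id"
  by (simp add: xtree_morphism_def)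

lemma morphism_comp:
  assumes "xtree_morphism S T f" "xtree_morphism T U g" shows "xtree_morphism S U (g \<circ> f)"
  unfolding xtree_morphism_def
proof (intro conjI)
  show "(g \<circ> f) ` tverts S \<subseteq> tverts U"
    using assms by (simp add: xtree_morphism_def image_subset_iff)
  have "edge_map (g \<circ> f) ` tedges S = edge_map g ` edge_map f ` tedges S"
    by (simp add: image_image edge_map_comp)
  moreover have "edge_map f ` tedges S \<subseteq> tedges T" "edge_map g ` tedges T \<subseteq> tedges U"
    using assms by (simp_all add: xtree_morphism_def)
  ultimately show "edge_map (g \<circ> f) ` tedges S \<subseteq> tedges U"
    by (metis image_mono subset_trans)
qed (use assms in \<open>simp_all add: xtree_morphism_def\<close>)

lemma morphism_rtrancl:
  assumes "xtree_morphism S T f" "(u, v) \<in> (dstep S)\<^sup>*" shows "(f u, f v) \<in> (dstep T)\<^sup>*"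
  using assms(2)
proof induction
  case (step v w)
  then obtain x where "(v, x, w) \<in> tedges S" by (auto simp: dstep_def)
  from dstepI[OF morphism_edge[OF assms(1) this]] step.IH show ?case
    by (rule rtrancl_into_rtrancl[rotated])
qed simp

lemma morphism_trancl:
  assumes f: "xtree_morphism S T f" and uv: "(u, v) \<in> (dstep S)\<^sup>+"
  shows "(f u, f v) \<in> (dstep T)\<^sup>+"
proof -
  obtain w where w: "(u, w) \<in> dstep S" "(w, v) \<in> (dstep S)\<^sup>*" using tranclD[OF uv] by blast
  then obtain x where "(u, x, w) \<in> tedges S" by (auto simp: dstep_def)
  from dstepI[OF morphism_edge[OF f this]] morphism_rtrancl[OF f w(2)] show ?thesis
    by (rule rtrancl_into_trancl2)
qed

lemma acyclic_if_morphism: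
  assumes "xtree_morphism S T f" "acyclic (dstep T)" shows "acyclic (dstep S)"
  using morphism_trancl[OF assms(1)] assms(2) unfolding acyclic_def by blast

text \<open>Both retracts and isomorphic copies are images \<open>f\<close> with an injective morphism \<open>g\<close> back to the tree,
and this suffices.\<close>

lemma arborescence_image:
  assumes T: "arborescence X T" and g: "xtree_morphism (xtree_image f T) T g"
    and inj: "inj_on g (f ` tverts T)"
  shows "arborescence X (xtree_image f T)"
proof -
  let ?I = "xtree_image f T"
  have edges: "tedges ?I \<subseteq> tverts ?I \<times> X \<times> tverts ?I"
    using arborescenceD(6)[OF T] by (auto simp: edge_map_def)
  have unique: "u = u' \<and> x = x'" if e: "(u, x, v) \<in> tedges ?I" "(u', x', v) \<in> tedges ?I" for u x u' x' v
  proof -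
    have "g u = g u' \<and> x = x'"
      using arborescenceD(11)[OF T morphism_edge[OF g e(1)] morphism_edge[OF g e(2)]] .
    moreover have "u \<in> f ` tverts T" "u' \<in> f ` tverts T" using subsetD[OF edges e(1)] subsetD[OF edges e(2)] by auto
    ultimately show ?thesis using inj by (auto dest: inj_onD)
  qed
  show ?thesis
  proof (rule arborescenceI[OF _ _ edges _ _ _ unique])
    show "(tstart ?I, v) \<in> (dstep ?I)\<^sup>*" if "v \<in> tverts ?I" for v
      using that morphism_rtrancl[OF morphism_onto_image[of T f]] arborescenceD(10)[OF T] by auto
    show "acyclic (dstep ?I)" using acyclic_if_morphism[OF g arborescenceD(5)[OF T]] .
  qed (use arborescenceD(1-4)[OF T] in simp_all)
qed

lemma inv_morphism:
  assumes T: "arborescence X T" and inj: "inj_on f (tverts T)"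
  shows "xtree_morphism (xtree_image f T) T (inv_into (tverts T) f)"
proof -
  have "edge_map (inv_into (tverts T) f) (edge_map f e) = e" if "e \<in> tedges T" for e
    using that arborescenceD(7,9)[OF T] inv_into_f_f[OF inj] by (cases e) auto
  then show ?thesis
    using inv_into_f_f[OF inj] arborescenceD(3,4)[OF T]
    by (simp add: xtree_morphism_def image_image image_subset_iff)
qed

lemma arborescence_inj_image:
  assumes T: "arborescence X T" and inj: "inj_on f (tverts T)"
  shows "arborescence X (xtree_image f T)"
  using arborescence_image[OF T inv_morphism[OF T inj]] by (simp add: inj_on_inv_into)

lemma tree_value_inj_image:
  assumes T: "arborescence X T" and inj: "inj_on f (tverts T)" and m: "tree_value T m"
  shows "tree_value (xtree_image f T) m"
  using tree_value_eqI[OF T morphism_onto_image inv_morphism[OF T inj] m] .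

lemma retraction_inclusion:
  "retraction_of T r \<Longrightarrow> xtree_morphism (xtree_image r T) T id"
  by (simp add: retraction_of_def xtree_morphism_def)

lemma arborescence_retract:
  assumes T: "arborescence X T" and r: "retraction_of T r"
  shows "arborescence X (xtree_image r T)"
  using arborescence_image[OF T retraction_inclusion[OF r]] by simp

lemma tree_value_retract:
  assumes T: "arborescence X T" and r: "retraction_of T r" and m: "tree_value T m"
  shows "tree_value (xtree_image r T) m"
  using tree_value_eqI[OF T morphism_onto_image retraction_inclusion[OF r] m] .

lemma xtree_iso_imp_image:
  assumes "xtree_iso S T"
  shows "\<exists>f. inj_on f (tverts S) \<and> T = xtree_image f S"
proof -
  obtain f where f: "xtree_morphism S T f" "bij_betw f (tverts S) (tverts T)"
    "bij_betw (edge_map f) (tedges S) (tedges T)"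
    using assms by (auto simp: xtree_iso_def)
  then have "T = xtree_image f S"
    by (intro xtree.equality) (simp_all add: bij_betw_def xtree_morphism_def)
  then show ?thesis using f(2) by (auto simp: bij_betw_def)
qed

section \<open>Pruned trees\<close>

text \<open>The powers of \<open>f\<close> on \<open>V\<close> are eventually periodic, and an exponent that is a large multiple of the
period yields an idempotent.\<close>

lemma idempotent_power:
  assumes fin: "finite V" and f: "f ` V \<subseteq> V"
  shows "\<exists>k>0. \<forall>v\<in>V. (f ^^ k) ((f ^^ k) v) = (f ^^ k) v"
proof -
  have closed: "(f ^^ n) v \<in> V" if "v \<in> V" for n v
    using f that by (induction n) auto
  let ?h = "\<lambda>n. restrict (f ^^ n) V"
  have "range ?h \<subseteq> V \<rightarrow>\<^sub>E V" using closed by auto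
  then have "finite (range ?h)" using finite_PiE[of V "\<lambda>_. V"] fin finite_subset by blast
  then have "\<not> inj ?h" using finite_imageD infinite_UNIV_nat by blast
  then obtain a b where "a \<noteq> b" "?h a = ?h b" by (auto simp: inj_on_def)
  then obtain a b where ab: "a < b" "?h a = ?h b" by (metis nat_neq_iff)
  have eq: "(f ^^ a) v = (f ^^ b) v" if "v \<in> V" for v
    using fun_cong[OF ab(2), of v] that by simp
  define p where "p = b - a"
  have shift: "(f ^^ (m + p)) v = (f ^^ m) v" if "v \<in> V" "a \<le> m" for m v
  proof -
    have "(f ^^ (m + p)) v = (f ^^ ((m - a) + b)) v" using ab(1) that(2) by (simp add: p_def)
    also have "\<dots> = (f ^^ (m - a)) ((f ^^ a) v)" by (simp add: funpow_add eq[OF that(1)])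
    also have "\<dots> = (f ^^ ((m - a) + a)) v" by (simp only: funpow_add o_apply)
    finally show ?thesis using that(2) by simp
  qed
  have period: "(f ^^ (m + j * p)) v = (f ^^ m) v" if "v \<in> V" "a \<le> m" for m j v
  proof (induction j)
    case (Suc j)
    have "(f ^^ (m + Suc j * p)) v = (f ^^ ((m + j * p) + p)) v" by (simp add: algebra_simps)
    also have "\<dots> = (f ^^ (m + j * p)) v" using that by (intro shift) auto
    finally show ?case using Suc by simp
  qed simp
  have p: "0 < p" using ab(1) by (simp add: p_def)
  then have "b * 1 \<le> b * p" by (intro mult_le_mono2) simp
  then have k: "0 < b * p" "a \<le> b * p" using ab(1) by linarith+
  have "(f ^^ (b * p)) ((f ^^ (b * p)) v) = (f ^^ (b * p)) v" if "v \<in> V" for v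
    using period[OF that k(2), of b] by (simp add: funpow_add)
  then show ?thesis using k(1) by blast
qed

text \<open>An idempotent power of an endomorphism is a retraction, hence the identity.\<close>

lemma pruned_endomorphism_inj:
  assumes T: "arborescence X T" and pr: "pruned T" and h: "xtree_morphism T T h"
  shows "inj_on h (tverts T)"
proof -
  have "h ` tverts T \<subseteq> tverts T" using h by (simp add: xtree_morphism_def)
  then obtain k where k: "k > 0" "\<forall>v\<in>tverts T. (h ^^ k) ((h ^^ k) v) = (h ^^ k) v"
    using idempotent_power[OF arborescenceD(1)[OF T]] by blast
  have "xtree_morphism T T (h ^^ n)" for n
  proof (induction n)
    case (Suc n)
    from morphism_comp[OF this h] show ?case by (simp only: funpow.simps)
  qed (simp only: funpow.simps morphism_id)
  then have "retraction_of T (h ^^ k)" using k(2) by (simp add: retraction_of_def)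
  then have id: "(h ^^ k) v = v" if "v \<in> tverts T" for v using pr that by (auto simp: pruned_def)
  obtain j where j: "k = Suc j" using k(1) by (cases k) auto
  show ?thesis
  proof (rule inj_onI)
    fix v w assume vw: "v \<in> tverts T" "w \<in> tverts T" "h v = h w"
    have "(h ^^ k) v = (h ^^ k) w" using vw(3) by (simp add: j funpow_Suc_right del: funpow.simps)
    then show "v = w" using id vw(1,2) by simp
  qed
qed

lemma edge_map_inj_on:
  assumes T: "arborescence X T" and inj: "inj_on f (tverts T)"
  shows "inj_on (edge_map f) (tedges T)"
proof (rule inj_onI)
  fix e e' assume e: "e \<in> tedges T" "e' \<in> tedges T" and eq: "edge_map f e = edge_map f e'"
  obtain u x v u' x' v' where uv: "e = (u, x, v)" "e' = (u', x', v')" by (cases e, cases e') auto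
  have "u \<in> tverts T" "v \<in> tverts T" "u' \<in> tverts T" "v' \<in> tverts T"
    using arborescenceD(7,9)[OF T] e uv by blast+
  then show "e = e'" using eq inj uv by (auto dest: inj_onD)
qed

lemma bij_betw_of_mutual_injections:
  assumes "finite A" "finite B" "inj_on f A" "f ` A \<subseteq> B" "inj_on g B" "g ` B \<subseteq> A"
  shows "bij_betw f A B"
proof -
  have "card A = card B" using assms card_inj_on_le[of f A B] card_inj_on_le[of g B A] by simp
  then show ?thesis using assms by (simp add: bij_betw_def card_image card_subset_eq)
qed

lemma pruned_mutual_morphisms_iso:
  assumes S: "arborescence X S" "pruned S" and T: "arborescence Y T" "pruned T"
    and f: "xtree_morphism S T f" and g: "xtree_morphism T S g"
  shows "xtree_iso S T"
proof -
  have injf: "inj_on f (tverts S)"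
    using pruned_endomorphism_inj[OF S morphism_comp[OF f g]] by (rule inj_on_imageI2)
  have injg: "inj_on g (tverts T)"
    using pruned_endomorphism_inj[OF T morphism_comp[OF g f]] by (rule inj_on_imageI2)
  have "bij_betw f (tverts S) (tverts T)"
    by (rule bij_betw_of_mutual_injections[OF _ _ injf _ injg])
      (use arborescenceD(1)[OF S(1)] arborescenceD(1)[OF T(1)] f g in \<open>simp_all add: xtree_morphism_def\<close>)
  moreover have "bij_betw (edge_map f) (tedges S) (tedges T)"
    by (rule bij_betw_of_mutual_injections[OF _ _ edge_map_inj_on[OF S(1) injf] _ edge_map_inj_on[OF T(1) injg]])
      (use arborescenceD(2)[OF S(1)] arborescenceD(2)[OF T(1)] f g in \<open>simp_all add: xtree_morphism_def\<close>)
  ultimately show ?thesis using f unfolding xtree_iso_def by blast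
qed

text \<open>A retract with the least number of vertices is pruned, because a retraction of a retract is a
retraction of the whole tree.\<close>

lemma pruned_retract_exists:
  assumes T: "arborescence X T"
  shows "\<exists>r. retraction_of T r \<and> pruned (xtree_image r T)"
proof -
  have "retraction_of T id" by (simp add: retraction_of_def morphism_id)
  then have "\<exists>r. retraction_of T r \<and>
      (\<forall>q. retraction_of T q \<longrightarrow> card (r ` tverts T) \<le> card (q ` tverts T))"
    by (rule ex_has_least_nat[of "retraction_of T" id "\<lambda>r. card (r ` tverts T)"])
  then obtain r where r: "retraction_of T r"
    and least: "\<And>q. retraction_of T q \<Longrightarrow> card (r ` tverts T) \<le> card (q ` tverts T)" by blast
  have "pruned (xtree_image r T)"
    unfolding pruned_def
  proof (intro allI impI ballI)
    fix q w assume q: "retraction_of (xtree_image r T) q" and w: "w \<in> tverts (xtree_image r T)"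
    have q_mor: "xtree_morphism (xtree_image r T) (xtree_image r T) q"
      and q_idem: "\<And>v. v \<in> r ` tverts T \<Longrightarrow> q (q v) = q v"
      using q by (auto simp: retraction_of_def)
    have r_fix: "r v = v" if "v \<in> r ` tverts T" for v
      using r that by (auto simp: retraction_of_def)
    have q_maps: "q v \<in> r ` tverts T" if "v \<in> r ` tverts T" for v
      using q_mor that by (auto simp: xtree_morphism_def)
    have "xtree_morphism T T (id \<circ> (q \<circ> r))"
      by (rule morphism_comp[OF morphism_comp[OF morphism_onto_image q_mor] retraction_inclusion[OF r]])
    moreover have "(q \<circ> r) ((q \<circ> r) v) = (q \<circ> r) v" if "v \<in> tverts T" for v
      using r_fix[OF q_maps[OF imageI[OF that]]] q_idem[OF imageI[OF that]] by simp
    ultimately have "retraction_of T (q \<circ> r)" by (simp add: retraction_of_def)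
    from least[OF this] have le: "card (r ` tverts T) \<le> card (q ` r ` tverts T)"
      by (simp add: image_comp)
    have "finite (r ` tverts T)" using arborescenceD(1)[OF T] by simp
    moreover have "q ` r ` tverts T \<subseteq> r ` tverts T" using q_maps by blast
    ultimately have "q ` r ` tverts T = r ` tverts T" using le by (intro card_seteq)
    then obtain w' where "w' \<in> r ` tverts T" "w = q w'" using w by auto
    then show "q w = w" using q_idem by simp
  qed
  then show ?thesis using r by blast
qed

lemma pruned_inj_image:
  assumes T: "arborescence X T" and inj: "inj_on f (tverts T)" and pr: "pruned T"
  shows "pruned (xtree_image f T)"
  unfolding pruned_def
proof (intro allI impI ballI)
  fix q w assume q: "retraction_of (xtree_image f T) q" and w: "w \<in> tverts (xtree_image f T)"
  define g where "g = inv_into (tverts T) f"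
  have q_mor: "xtree_morphism (xtree_image f T) (xtree_image f T) q"
    and q_idem: "\<And>v. v \<in> f ` tverts T \<Longrightarrow> q (q v) = q v"
    using q by (auto simp: retraction_of_def)
  have fg: "f (g v) = v" if "v \<in> f ` tverts T" for v using that by (simp add: g_def f_inv_into_f)
  have q_maps: "q v \<in> f ` tverts T" if "v \<in> f ` tverts T" for v
    using q_mor that by (auto simp: xtree_morphism_def)
  have "xtree_morphism T T (g \<circ> (q \<circ> f))"
    unfolding g_def
    by (rule morphism_comp[OF morphism_comp[OF morphism_onto_image q_mor] inv_morphism[OF T inj]])
  moreover have "(g \<circ> (q \<circ> f)) ((g \<circ> (q \<circ> f)) v) = (g \<circ> (q \<circ> f)) v" if "v \<in> tverts T" for v
    using fg[OF q_maps[OF imageI[OF that]]] q_idem[OF imageI[OF that]] by simp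
  ultimately have "retraction_of T (g \<circ> (q \<circ> f))" by (simp add: retraction_of_def)
  then have fix_all: "\<forall>v\<in>tverts T. (g \<circ> (q \<circ> f)) v = v"
    using pr unfolding pruned_def by blast
  obtain v where v: "v \<in> tverts T" "w = f v" using w by auto
  have "q w = f (g (q w))" using fg q_maps w by simp
  also have "\<dots> = w" using fix_all v by simp
  finally show "q w = w" .
qed

text \<open>The pruned tree of \<open>T\<close> is characterised by the value alone. In particular a product in \<open>FLE X\<close> can be
computed on values.\<close>

lemma pruning_of_iff:
  assumes T: "arborescence X T" and m: "tree_value T m"
  shows "pruning_of T U \<longleftrightarrow> arborescence X U \<and> pruned U \<and> tree_value U m"
proof
  assume "pruning_of T U"
  then obtain r where r: "retraction_of T r" "xtree_iso (xtree_image r T) U" "pruned U"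
    by (auto simp: pruning_of_def)
  obtain f where f: "inj_on f (tverts (xtree_image r T))" "U = xtree_image f (xtree_image r T)"
    using xtree_iso_imp_image[OF r(2)] by blast
  note R = arborescence_retract[OF T r(1)]
  show "arborescence X U \<and> pruned U \<and> tree_value U m"
    using arborescence_inj_image[OF R f(1)] tree_value_inj_image[OF R f(1) tree_value_retract[OF T r(1) m]]
      r(3) f(2) by simp
next
  assume U: "arborescence X U \<and> pruned U \<and> tree_value U m"
  obtain r where r: "retraction_of T r" "pruned (xtree_image r T)"
    using pruned_retract_exists[OF T] by blast
  note R = arborescence_retract[OF T r(1)] and Rm = tree_value_retract[OF T r(1) m]
  obtain f where f: "xtree_morphism (xtree_image r T) U f"
    using morphism_if_same_value[OF R _ Rm] U by blast
  obtain g where g: "xtree_morphism U (xtree_image r T) g"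
    using morphism_if_same_value[OF _ R _ Rm] U by blast
  have "xtree_iso (xtree_image r T) U"
    using pruned_mutual_morphisms_iso[OF R r(2) _ _ f g] U by blast
  then show "pruning_of T U" using U r(1) unfolding pruning_of_def by blast
qed

definition trees_of_value :: "'x set \<Rightarrow> 'x trunk \<Rightarrow> (nat, 'x) xtree set" where
  "trees_of_value X m = {U. arborescence X U \<and> pruned U \<and> tree_value U m}"

text \<open>Pruned trees are isomorphic if and only if their values agree.\<close>

lemma iso_type_eq:
  assumes T: "arborescence X T" and pr: "pruned T" and m: "tree_value T m"
  shows "iso_type T = trees_of_value X m"
proof (intro subset_antisym subsetI)
  fix U assume "U \<in> iso_type T"
  then obtain f where f: "inj_on f (tverts T)" "U = xtree_image f T"
    using xtree_iso_imp_image by (auto simp: iso_type_def)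
  show "U \<in> trees_of_value X m"
    using arborescence_inj_image[OF T f(1)] tree_value_inj_image[OF T f(1) m]
      pruned_inj_image[OF T f(1) pr] f(2) by (simp add: trees_of_value_def)
next
  fix U assume "U \<in> trees_of_value X m"
  then have U: "arborescence X U" "pruned U" "tree_value U m" by (auto simp: trees_of_value_def)
  obtain f where f: "xtree_morphism T U f" using morphism_if_same_value[OF T U(1) m U(3)] by blast
  obtain g where g: "xtree_morphism U T g" using morphism_if_same_value[OF U(1) T U(3) m] by blast
  show "U \<in> iso_type T"
    using pruned_mutual_morphisms_iso[OF T pr U(1,2) f g] by (simp add: iso_type_def)
qed

text \<open>The tree may have vertices of any type: its pruned retract is finite and can be renamed.\<close>

lemma trees_of_value_nonempty:
  fixes T :: "('v, 'x) xtree"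
  assumes T: "arborescence X T" and m: "tree_value T m"
  shows "trees_of_value X m \<noteq> {}"
proof -
  obtain r where r: "retraction_of T r" "pruned (xtree_image r T)"
    using pruned_retract_exists[OF T] by blast
  note R = arborescence_retract[OF T r(1)] and Rm = tree_value_retract[OF T r(1) m]
  obtain f :: "'v \<Rightarrow> nat" where f: "inj_on f (tverts (xtree_image r T))"
    using finite_imp_inj_to_nat_seg[OF arborescenceD(1)[OF R]] by blast
  have "xtree_image f (xtree_image r T) \<in> trees_of_value X m"
    using arborescence_inj_image[OF R f] tree_value_inj_image[OF R f Rm]
      pruned_inj_image[OF R f r(2)] by (simp add: trees_of_value_def)
  then show ?thesis by blast
qed

section \<open>Products of trees\<close>

lemma glue_right_eq_iff [simp]: "glue_right S T v = glue_right S T w \<longleftrightarrow> v = w"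
  by (simp add: glue_right_def)

lemma glue_right_start [simp]: "glue_right S T (tstart T) = Inl (tend S)"
  by (simp add: glue_right_def)

lemma glue_right_other: "w \<noteq> tstart T \<Longrightarrow> glue_right S T w = Inr w"
  by (simp add: glue_right_def)

lemma xtree_prod_simps [simp]:
  "tverts (xtree_prod S T) = Inl ` tverts S \<union> glue_right S T ` tverts T"
  "tedges (xtree_prod S T) = edge_map Inl ` tedges S \<union> edge_map (glue_right S T) ` tedges T"
  "tstart (xtree_prod S T) = Inl (tstart S)" "tend (xtree_prod S T) = glue_right S T (tend T)"
  by (simp_all add: xtree_prod_def)

lemma no_edge_into_start:
  assumes T: "arborescence X T" shows "(u, x, tstart T) \<notin> tedges T"
proof
  assume e: "(u, x, tstart T) \<in> tedges T"
  show False using no_way_back[OF T e] arborescenceD(10)[OF T arborescenceD(7)[OF T e]] by blast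
qed

context
  fixes X :: "'x set" and S :: "('v, 'x) xtree" and T :: "('w, 'x) xtree"
  assumes S: "arborescence X S" and T: "arborescence X T"
begin

lemma prod_edge_cases:
  assumes "(a, x, b) \<in> tedges (xtree_prod S T)"
  obtains (left) u v where "a = Inl u" "b = Inl v" "(u, x, v) \<in> tedges S"
    | (right) u v where "a = glue_right S T u" "b = Inr v" "(u, x, v) \<in> tedges T"
proof -
  consider (l) e where "e \<in> tedges S" "(a, x, b) = edge_map Inl e"
    | (r) e where "e \<in> tedges T" "(a, x, b) = edge_map (glue_right S T) e"
    using assms by auto
  then show thesis
  proof cases
    case l
    then show thesis using left by (cases e) simp
  next
    case r
    obtain u y v where e: "e = (u, y, v)" by (cases e) auto
    then have uv: "a = glue_right S T u" "b = glue_right S T v" "(u, x, v) \<in> tedges T"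
      using r by simp_all
    then have "v \<noteq> tstart T" using no_edge_into_start[OF T] by blast
    then show thesis using right[OF uv(1) _ uv(3)] uv(2) by (simp add: glue_right_other)
  qed
qed

lemma left_edge: "(u, x, v) \<in> tedges S \<Longrightarrow> (Inl u, x, Inl v) \<in> tedges (xtree_prod S T)"
  unfolding xtree_prod_simps by (rule UnI1, rule image_eqI[of _ _ "(u, x, v)"]) simp_all

lemma right_edge:
  assumes e: "(u, x, v) \<in> tedges T"
  shows "(glue_right S T u, x, Inr v) \<in> tedges (xtree_prod S T)"
proof -
  have "v \<noteq> tstart T" using e no_edge_into_start[OF T] by blast
  then show ?thesis
    using imageI[OF e, of "edge_map (glue_right S T)"] by (simp add: glue_right_other)
qed

lemma left_reach: "(u, v) \<in> (dstep S)\<^sup>* \<Longrightarrow> (Inl u, Inl v) \<in> (dstep (xtree_prod S T))\<^sup>*"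
proof (induction rule: rtrancl_induct)
  case (step v w)
  then obtain x where "(v, x, w) \<in> tedges S" by (auto simp: dstep_def)
  from dstepI[OF left_edge[OF this]] step.IH show ?case by (rule rtrancl_into_rtrancl[rotated])
qed simp

lemma right_reach:
  "(u, v) \<in> (dstep T)\<^sup>* \<Longrightarrow> (glue_right S T u, glue_right S T v) \<in> (dstep (xtree_prod S T))\<^sup>*"
proof (induction rule: rtrancl_induct)
  case (step v w)
  then obtain x where e: "(v, x, w) \<in> tedges T" by (auto simp: dstep_def)
  have "w \<noteq> tstart T" using e no_edge_into_start[OF T] by blast
  then have "(glue_right S T v, glue_right S T w) \<in> dstep (xtree_prod S T)"
    using dstepI[OF right_edge[OF e]] by (simp add: glue_right_other)
  with step.IH show ?case by (rule rtrancl_into_rtrancl)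
qed simp

text \<open>A directed path in the product may pass from the first factor to the second one, but never back.
The vertex shared by both factors counts as a vertex of the first.\<close>

lemma prod_trancl:
  assumes "(a, b) \<in> (dstep (xtree_prod S T))\<^sup>+"
  shows "case b of Inl v \<Rightarrow> \<exists>u. a = Inl u \<and> (u, v) \<in> (dstep S)\<^sup>+
    | Inr w \<Rightarrow> \<forall>w'. a = Inr w' \<longrightarrow> (w', w) \<in> (dstep T)\<^sup>+"
  using assms
proof (induction rule: trancl_induct)
  case (base b)
  then obtain x where "(a, x, b) \<in> tedges (xtree_prod S T)" by (auto simp: dstep_def)
  then show ?case
  proof (cases rule: prod_edge_cases)
    case (left u v)
    then show ?thesis using dstepI[OF left(3)] by auto
  next
    case (right u v)
    then show ?thesis using dstepI[OF right(3)] by (auto simp: glue_right_def split: if_splits)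
  qed
next
  case (step b c)
  then obtain x where "(b, x, c) \<in> tedges (xtree_prod S T)" by (auto simp: dstep_def)
  then show ?case
  proof (cases rule: prod_edge_cases)
    case (left u v)
    then obtain u' where "a = Inl u'" "(u', u) \<in> (dstep S)\<^sup>+" using step.IH by auto
    then show ?thesis using left(2) trancl_into_trancl[OF _ dstepI[OF left(3)]] by simp
  next
    case (right u v)
    show ?thesis
    proof (cases "u = tstart T")
      case True
      then show ?thesis using right step.IH by auto
    next
      case False
      then have "\<forall>w'. a = Inr w' \<longrightarrow> (w', u) \<in> (dstep T)\<^sup>+"
        using right(1) step.IH by (simp add: glue_right_other)
      then show ?thesis using right(2) trancl_into_trancl[OF _ dstepI[OF right(3)]] by simp
    qed
  qed
qed

lemma arborescence_prod: "arborescence X (xtree_prod S T)"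
proof (rule arborescenceI)
  let ?P = "xtree_prod S T"
  show "finite (tverts ?P)" "finite (tedges ?P)"
    using arborescenceD(1,2)[OF S] arborescenceD(1,2)[OF T] by simp_all
  show "tstart ?P \<in> tverts ?P" "tend ?P \<in> tverts ?P"
    using arborescenceD(3)[OF S] arborescenceD(4)[OF T] by simp_all
  show "tedges ?P \<subseteq> tverts ?P \<times> X \<times> tverts ?P"
    using arborescenceD(6)[OF S] arborescenceD(6)[OF T] by (auto simp: edge_map_def)
  show "(tstart ?P, v) \<in> (dstep ?P)\<^sup>*" if v: "v \<in> tverts ?P" for v
  proof -
    have left: "(tstart ?P, Inl u) \<in> (dstep ?P)\<^sup>*" if "u \<in> tverts S" for u
      using left_reach[OF arborescenceD(10)[OF S that]] by simp
    consider (l) u where "v = Inl u" "u \<in> tverts S" | (r) w where "v = glue_right S T w" "w \<in> tverts T"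
      using v by auto
    then show ?thesis
    proof cases
      case l
      then show ?thesis using left by simp
    next
      case r
      have "(Inl (tend S), v) \<in> (dstep ?P)\<^sup>*"
        using right_reach[OF arborescenceD(10)[OF T r(2)]] r(1) by simp
      then show ?thesis using left[OF arborescenceD(4)[OF S]] by (rule rtrancl_trans[rotated])
    qed
  qed
  show "a = a' \<and> x = x'" if e: "(a, x, b) \<in> tedges ?P" and e': "(a', x', b) \<in> tedges ?P" for a x a' x' b
    using e
  proof (cases rule: prod_edge_cases)
    case (left u v)
    note l = left
    from e' show ?thesis
    proof (cases rule: prod_edge_cases)
      case (left u' v')
      then show ?thesis using l arborescenceD(11)[OF S, of u x v u' x'] by simp
    qed (use l in simp)
  next
    case (right u v)
    note r = right
    from e' show ?thesis
    proof (cases rule: prod_edge_cases)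
      case (right u' v')
      then show ?thesis using r arborescenceD(11)[OF T, of u x v u' x'] by simp
    qed (use r in simp)
  qed
  have "(a, a) \<notin> (dstep ?P)\<^sup>+" for a
  proof
    assume "(a, a) \<in> (dstep ?P)\<^sup>+"
    from prod_trancl[OF this] show False
      using arborescenceD(5)[OF S] arborescenceD(5)[OF T]
      by (cases a) (simp_all add: acyclic_def)
  qed
  then show "acyclic (dstep ?P)" by (simp add: acyclic_def)
qed

lemma theory_at_right:
  assumes "w \<noteq> tstart T"
  shows "theory_at (xtree_prod S T) (Inr w) = theory_at T w"
proof -
  have edges: "(Inr w, x, b) \<in> tedges (xtree_prod S T) \<longleftrightarrow>
      (\<exists>w'. w' \<noteq> tstart T \<and> b = Inr w' \<and> (w, x, w') \<in> tedges T)" if w: "w \<noteq> tstart T" for w x b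
  proof
    assume "(Inr w, x, b) \<in> tedges (xtree_prod S T)"
    then show "\<exists>w'. w' \<noteq> tstart T \<and> b = Inr w' \<and> (w, x, w') \<in> tedges T"
    proof (cases rule: prod_edge_cases)
      case (right u v)
      moreover have "v \<noteq> tstart T" using right(3) no_edge_into_start[OF T] by blast
      moreover have "u = w" using right(1) by (simp add: glue_right_def split: if_splits)
      ultimately show ?thesis by simp
    qed simp
  next
    assume "\<exists>w'. w' \<noteq> tstart T \<and> b = Inr w' \<and> (w, x, w') \<in> tedges T"
    then show "(Inr w, x, b) \<in> tedges (xtree_prod S T)"
      using right_edge[of w x] glue_right_other[OF w, of S] by auto
  qed
  have holds_eq: "w \<noteq> tstart T \<Longrightarrow> holds (xtree_prod S T) t (Inr w) \<longleftrightarrow> holds T t w" for t w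
  proof (induction t arbitrary: w)
    case (Br x t s)
    have "w' \<noteq> tstart T" if "(w, x, w') \<in> tedges T" for w'
      using that no_edge_into_start[OF T] by blast
    then show ?case using Br edges[OF Br.prems] by (auto simp del: xtree_prod_simps)
  qed simp
  have "w' \<noteq> tstart T" if "(w, x, w') \<in> tedges T" for x w'
    using that no_edge_into_start[OF T] by blast
  then have "(\<exists>b. (Inr w, x, b) \<in> tedges (xtree_prod S T) \<and> holds (xtree_prod S T) t b) \<longleftrightarrow>
      (\<exists>w'. (w, x, w') \<in> tedges T \<and> holds T t w')" for x t
    unfolding edges[OF assms] using holds_eq by blast
  then show ?thesis unfolding theory_at_def by simp
qed

text \<open>From a vertex of the first factor that does not lie on its trunk, the second factor cannot be
reached.\<close>

lemma theory_at_off_trunk: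
  assumes "(v, tend S) \<notin> (dstep S)\<^sup>*"
  shows "theory_at (xtree_prod S T) (Inl v) = theory_at S v"
proof -
  have edges: "(Inl v, x, b) \<in> tedges (xtree_prod S T) \<longleftrightarrow>
      (\<exists>v'. b = Inl v' \<and> (v, x, v') \<in> tedges S)" if v: "v \<noteq> tend S" for v x b
  proof
    assume "(Inl v, x, b) \<in> tedges (xtree_prod S T)"
    then show "\<exists>v'. b = Inl v' \<and> (v, x, v') \<in> tedges S"
    proof (cases rule: prod_edge_cases)
      case (right u w)
      then have "v = tend S" by (simp add: glue_right_def split: if_splits)
      then show ?thesis using v by simp
    qed simp
  qed (use left_edge in auto)
  have step: "(v', tend S) \<notin> (dstep S)\<^sup>*"
    if "(v, tend S) \<notin> (dstep S)\<^sup>*" "(v, x, v') \<in> tedges S" for v x v'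
    using that(1) converse_rtrancl_into_rtrancl[OF dstepI[OF that(2)]] by blast
  have holds_eq: "(v, tend S) \<notin> (dstep S)\<^sup>* \<Longrightarrow>
      holds (xtree_prod S T) t (Inl v) \<longleftrightarrow> holds S t v" for t v
  proof (induction t arbitrary: v)
    case (Br x t s)
    then have "v \<noteq> tend S" by auto
    from edges[OF this] show ?case
      using Br.IH step[OF Br.prems] Br.prems by (auto simp del: xtree_prod_simps)
  qed simp
  have "v \<noteq> tend S" using assms by auto
  then have "(\<exists>b. (Inl v, x, b) \<in> tedges (xtree_prod S T) \<and> holds (xtree_prod S T) t b) \<longleftrightarrow>
      (\<exists>v'. (v, x, v') \<in> tedges S \<and> holds S t v')" for x t
    unfolding edges[OF \<open>v \<noteq> tend S\<close>] using holds_eq[OF step[OF assms]] by blast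
  then show ?thesis unfolding theory_at_def by simp
qed

lemma theory_at_glue:
  "theory_at (xtree_prod S T) (Inl (tend S)) = theory_at S (tend S) \<union> theory_at T (tstart T)"
proof (rule subset_antisym)
  show "theory_at (xtree_prod S T) (Inl (tend S)) \<subseteq> theory_at S (tend S) \<union> theory_at T (tstart T)"
  proof
    fix k assume "k \<in> theory_at (xtree_prod S T) (Inl (tend S))"
    then obtain x t b where k: "k = (x, t)" "(Inl (tend S), x, b) \<in> tedges (xtree_prod S T)"
      "kids t \<subseteq> theory_at (xtree_prod S T) b" by (cases k) (auto simp: mem_theory_at simp del: xtree_prod_simps)
    from k(2) show "k \<in> theory_at S (tend S) \<union> theory_at T (tstart T)"
    proof (cases rule: prod_edge_cases)
      case (left u v)
      then have "(v, tend S) \<notin> (dstep S)\<^sup>*" using no_way_back[OF S, of "tend S" x v] by simp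
      then show ?thesis using left k theory_at_off_trunk by (auto simp: mem_theory_at)
    next
      case (right u v)
      then have "u = tstart T" by (simp add: glue_right_def split: if_splits)
      moreover have "v \<noteq> tstart T" using right no_edge_into_start[OF T] by blast
      ultimately show ?thesis using right k theory_at_right by (auto simp: mem_theory_at)
    qed
  qed
  have "theory_at S (tend S) \<subseteq> theory_at (xtree_prod S T) (Inl (tend S))"
    by (rule theory_at_mono[OF left_edge])
  moreover have "theory_at T (tstart T) \<subseteq> theory_at (xtree_prod S T) (glue_right S T (tstart T))"
  proof (rule theory_at_mono)
    fix u x v assume e: "(u, x, v) \<in> tedges T"
    then have "v \<noteq> tstart T" using no_edge_into_start[OF T] by blast
    then show "(glue_right S T u, x, glue_right S T v) \<in> tedges (xtree_prod S T)"
      using right_edge[OF e] by (simp add: glue_right_other)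
  qed
  ultimately show "theory_at S (tend S) \<union> theory_at T (tstart T)
      \<subseteq> theory_at (xtree_prod S T) (Inl (tend S))" by simp
qed

text \<open>The only child of \<open>v\<close> whose theory changes in the product is the next vertex \<open>v1\<close> of the trunk.\<close>

lemma theory_at_trunk:
  assumes e: "(v, x, v1) \<in> tedges S" and reach: "(v1, tend S) \<in> (dstep S)\<^sup>*"
  shows "theory_at (xtree_prod S T) (Inl v) =
    theory_at S v \<union> dia x (theory_at (xtree_prod S T) (Inl v1))"
proof (rule subset_antisym)
  show "theory_at (xtree_prod S T) (Inl v) \<subseteq>
    theory_at S v \<union> dia x (theory_at (xtree_prod S T) (Inl v1))"
  proof
    fix k assume "k \<in> theory_at (xtree_prod S T) (Inl v)"
    then obtain y t b where k: "k = (y, t)" "(Inl v, y, b) \<in> tedges (xtree_prod S T)"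
      "kids t \<subseteq> theory_at (xtree_prod S T) b" by (cases k) (auto simp: mem_theory_at simp del: xtree_prod_simps)
    from k(2) show "k \<in> theory_at S v \<union> dia x (theory_at (xtree_prod S T) (Inl v1))"
    proof (cases rule: prod_edge_cases)
      case (left u v2)
      then have e2: "(v, y, v2) \<in> tedges S" by simp
      show ?thesis
      proof (cases "(v2, tend S) \<in> (dstep S)\<^sup>*")
        case True
        have "v1 = v2 \<and> x = y" using trunk_child_unique[OF S e e2 reach True] .
        then show ?thesis using k left by simp
      next
        case False
        then have "kids t \<subseteq> theory_at S v2" using k(3) left(2) theory_at_off_trunk by simp
        then show ?thesis using e2 k(1) by (auto simp: mem_theory_at)
      qed
    next
      case (right u w)
      then have "v = tend S" by (simp add: glue_right_def split: if_splits)
      then show ?thesis using no_way_back[OF S e] reach by simp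
    qed
  qed
  have "theory_at S v \<subseteq> theory_at (xtree_prod S T) (Inl v)"
    by (rule theory_at_mono[OF left_edge])
  then show "theory_at S v \<union> dia x (theory_at (xtree_prod S T) (Inl v1))
      \<subseteq> theory_at (xtree_prod S T) (Inl v)"
    using dia_subset_theory_at[OF left_edge[OF e]] by simp
qed

lemma trunk_value_right:
  "trunk_value T w n \<Longrightarrow> w \<noteq> tstart T \<Longrightarrow> trunk_value (xtree_prod S T) (Inr w) n"
proof (induction rule: trunk_value.induct)
  case at_end
  then show ?case
    using trunk_value.at_end[of "xtree_prod S T"] theory_at_right[OF at_end]
    by (simp add: glue_right_other)
next
  case (at_edge w x w' n)
  have "w' \<noteq> tstart T" using at_edge.hyps(1) no_edge_into_start[OF T] by blast
  moreover have "(Inr w, x, Inr w') \<in> tedges (xtree_prod S T)"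
    using right_edge[OF at_edge.hyps(1)] unfolding glue_right_other[OF at_edge.prems, of S] .
  ultimately show ?case
    using trunk_value.at_edge[of "Inr w" x "Inr w'" "xtree_prod S T" n] at_edge.IH
      theory_at_right[OF at_edge.prems] by simp
qed

lemma trunk_value_glue:
  assumes "trunk_value T (tstart T) n"
  shows "trunk_value (xtree_prod S T) (Inl (tend S)) (enlarge (theory_at S (tend S)) n)"
  using assms
proof (cases rule: trunk_value.cases)
  case at_end
  have "tend (xtree_prod S T) = Inl (tend S)" by (simp add: at_end(1)[symmetric])
  then show ?thesis
    using trunk_value.at_end[of "xtree_prod S T"] at_end theory_at_glue by simp
next
  case (at_edge x w n')
  have "w \<noteq> tstart T" using at_edge(2) no_edge_into_start[OF T] by blast
  then have "trunk_value (xtree_prod S T) (Inr w) n'" using at_edge(3) by (intro trunk_value_right)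
  moreover have "(Inl (tend S), x, Inr w) \<in> tedges (xtree_prod S T)"
    using right_edge[OF at_edge(2)] by (simp only: glue_right_start)
  ultimately have "trunk_value (xtree_prod S T) (Inl (tend S))
      (Step (theory_at (xtree_prod S T) (Inl (tend S))) x n')" by (rule trunk_value.at_edge[rotated])
  then show ?thesis by (simp add: at_edge(1) theory_at_glue)
qed

lemma trunk_value_left:
  assumes n: "trunk_value T (tstart T) n"
  shows "trunk_value S v m \<Longrightarrow> trunk_value (xtree_prod S T) (Inl v) (m \<star> n)"
proof (induction rule: trunk_value.induct)
  case at_end
  then show ?case using trunk_value_glue[OF n] by simp
next
  case (at_edge v x v' m)
  have "trunk_value (xtree_prod S T) (Inl v)
      (Step (theory_at (xtree_prod S T) (Inl v)) x (m \<star> n))"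
    using left_edge[OF at_edge.hyps(1)] at_edge.IH by (rule trunk_value.at_edge)
  then show ?case
    by (simp add: theory_at_trunk[OF at_edge.hyps(1) trunk_value_reaches[OF at_edge.hyps(2)]]
        first_trunk_value[OF at_edge.IH])
qed

lemma tree_value_prod:
  assumes "tree_value S m" "tree_value T n" shows "tree_value (xtree_prod S T) (m \<star> n)"
  using assms trunk_value_left[of n "tstart S" m] by (simp add: tree_value_def)

end

section \<open>Every trunk is the trunk of a tree\<close>

lemma tree_of_valueE:
  assumes "U \<in> trees_of_value X m"
  shows "arborescence X U" "pruned U" "tree_value U m"
  using assms by (simp_all add: trees_of_value_def)

lemma realize_mult:
  assumes "trees_of_value X m \<noteq> {}" "trees_of_value X n \<noteq> {}"
  shows "trees_of_value X (m \<star> n) \<noteq> {}"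
proof -
  obtain S T where "S \<in> trees_of_value X m" "T \<in> trees_of_value X n" using assms by blast
  note S = tree_of_valueE[OF this(1)] and T = tree_of_valueE[OF this(2)]
  show ?thesis
    using trees_of_value_nonempty[OF arborescence_prod[OF S(1) T(1)]
        tree_value_prod[OF S(1) T(1) S(3) T(3)]] .
qed

lemma realize_one: "trees_of_value X (End {}) \<noteq> {}"
proof (rule trees_of_value_nonempty)
  let ?T = "\<lparr>tverts = {0 :: nat}, tedges = {}, tstart = 0, tend = 0\<rparr> :: (nat, 'a) xtree"
  show "arborescence X ?T" by (rule arborescenceI) (simp_all add: dstep_def acyclic_def)
  have "theory_at ?T 0 = {}" by (simp add: theory_at_def)
  then show "tree_value ?T (End {})" using at_end[of ?T] by (simp add: tree_value_def)
qed

lemma realize_edge: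
  assumes "x \<in> X" shows "trees_of_value X (Step (dia x {}) x (End {})) \<noteq> {}"
proof (rule trees_of_value_nonempty)
  let ?T = "\<lparr>tverts = {0, Suc 0}, tedges = {(0, x, Suc 0)}, tstart = 0, tend = Suc 0\<rparr>"
  have d: "dstep ?T = {(0, Suc 0)}" by (auto simp: dstep_def)
  have "(a, b) \<in> (dstep ?T)\<^sup>+ \<Longrightarrow> a < b" for a b
    by (induction rule: trancl_induct) (auto simp: d)
  then have "acyclic (dstep ?T)" by (auto simp: acyclic_def)
  then show "arborescence X ?T"
    using assms by (intro arborescenceI) (auto simp: d)
  have th1: "theory_at ?T (Suc 0) = {}" by (simp add: theory_at_def)
  then have th0: "theory_at ?T 0 = dia x {}" by (auto simp: mem_theory_at)
  have "trunk_value ?T (Suc 0) (End {})" using at_end[of ?T] th1 by simp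
  from at_edge[of 0 x "Suc 0" ?T, OF _ this] show "tree_value ?T (Step (dia x {}) x (End {}))"
    by (simp add: tree_value_def th0)
qed

lemma realize_first:
  assumes "trees_of_value X m \<noteq> {}" shows "trees_of_value X (End (first_theory m)) \<noteq> {}"
proof -
  obtain T where "T \<in> trees_of_value X m" using assms by blast
  note T = tree_of_valueE[OF this]
  let ?T = "T\<lparr>tend := tstart T\<rparr>"
  have d: "dstep ?T = dstep T" by (simp add: dstep_def)
  have arb: "arborescence X ?T"
    using arborescenceD[OF T(1)] by (intro arborescenceI) (simp_all add: d)
  have "theory_at ?T v = theory_at T v" for v
    using theory_at_mono[of ?T id T v] theory_at_mono[of T id ?T v] by auto
  moreover have "first_theory m = theory_at T (tstart T)"
    using T(3) unfolding tree_value_def by (rule first_trunk_value)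
  ultimately have "tree_value ?T (End (first_theory m))"
    using at_end[of ?T] by (simp add: tree_value_def)
  from trees_of_value_nonempty[OF arb this] show ?thesis .
qed

lemma realize_prefix:
  assumes "x \<in> X" "trees_of_value X m \<noteq> {}"
  shows "trees_of_value X (Step (dia x (first_theory m)) x m) \<noteq> {}"
proof -
  have "dia x {} \<union> dia x (first_theory m) = dia x (first_theory m)"
    using dia_mono[of "{}" "first_theory m" x] by blast
  then have "Step (dia x {}) x (End {}) \<star> m = Step (dia x (first_theory m)) x m"
    by (simp add: enlarge_id)
  then show ?thesis using realize_mult[OF realize_edge[OF assms(1)] assms(2)] by simp
qed

text \<open>Prefixing an edge \<open>x\<close> to a tree for \<open>down t\<close> and moving the end to the start realises \<open>dia x (down t)\<close>;
the product with a tree for \<open>down s\<close> joins the two at the root.\<close>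

lemma realize_idempotent:
  "set_branches t \<subseteq> X \<Longrightarrow> trees_of_value X (End (down t)) \<noteq> {}"
proof (induction t)
  case Leaf
  then show ?case using realize_one by simp
next
  case (Br x t s)
  then have "trees_of_value X (End (dia x (down t))) \<noteq> {}"
    using realize_first[OF realize_prefix[of x X "End (down t)"]] by simp
  from realize_mult[OF this, of "End (down s)"] Br show ?case by simp
qed

lemma realize_fin_gen: "fin_gen X U \<Longrightarrow> trees_of_value X (End U) \<noteq> {}"
  using realize_idempotent fin_genE by metis

text \<open>A trunk is the product of the trunk \<open>End U\<close> for its first theory, its first edge and the rest: by the
last condition of admissibility \<open>U\<close> absorbs what the product adds.\<close>

lemma realize: "admissible X m \<Longrightarrow> trees_of_value X m \<noteq> {}"
proof (induction m)
  case (End U)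
  then show ?case using realize_fin_gen by simp
next
  case (Step U x m)
  then have "trees_of_value X (End U) \<noteq> {}" using realize_fin_gen[of X U] by simp
  from realize_mult[OF this realize_prefix[of x X m]]
  have "trees_of_value X (Step (U \<union> dia x (first_theory m)) x m) \<noteq> {}" using Step by simp
  then show ?case using Step.prems by (simp add: Un_absorb2)
qed

section \<open>The free left Ehresmann monoid is the monoid of trunks\<close>

lemma carrier_FLE:
  fixes X :: "'x set"
  shows "carrier (FLE X) = trees_of_value X ` {m. admissible X m}"
proof (intro subset_antisym subsetI)
  fix A assume "A \<in> carrier (FLE X)"
  then obtain T :: "(nat, 'x) xtree" where A: "A = iso_type T" "is_xtree X T" "left_ehresmann T" "pruned T"
    by (auto simp: FLE_def)
  note T = A(1) xtree_imp_arborescence[OF A(2,3)] A(4)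
  obtain m where m: "tree_value T m" using tree_value_exists[OF T(2)] by blast
  show "A \<in> trees_of_value X ` {m. admissible X m}"
    using iso_type_eq[OF T(2,3) m] T(1) admissible_tree_value[OF T(2) m] by blast
next
  fix A assume "A \<in> trees_of_value X ` {m. admissible X m}"
  then obtain m where m: "A = trees_of_value X m" "admissible X m" by blast
  obtain T where "T \<in> trees_of_value X m" using realize[OF m(2)] by blast
  note T = tree_of_valueE[OF this]
  have "A = iso_type T" using iso_type_eq[OF T] m(1) by simp
  then show "A \<in> carrier (FLE X)"
    using arborescence_imp_xtree[OF T(1)] T(2) by (auto simp: FLE_def)
qed

lemma mult_FLE:
  assumes "admissible X m" "admissible X n"
  shows "trees_of_value X m \<otimes>\<^bsub>FLE X\<^esub> trees_of_value X n = trees_of_value X (m \<star> n)"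
proof -
  have prune: "pruning_of (xtree_prod S T) U \<longleftrightarrow> U \<in> trees_of_value X (m \<star> n)"
    if S: "S \<in> trees_of_value X m" and T: "T \<in> trees_of_value X n" for S T U
    using pruning_of_iff[OF arborescence_prod tree_value_prod] tree_of_valueE[OF S] tree_of_valueE[OF T]
    by (simp add: trees_of_value_def)
  have "trees_of_value X m \<noteq> {}" "trees_of_value X n \<noteq> {}" using realize assms by blast+
  then show ?thesis using prune by (auto simp: FLE_def)
qed

lemma one_FLE: "\<one>\<^bsub>FLE X\<^esub> = trees_of_value X (End {})"
proof -
  let ?T = "\<lparr>tverts = {0 :: nat}, tedges = {}, tstart = 0, tend = 0\<rparr> :: (nat, 'a) xtree"
  have "theory_at ?T 0 = {}" by (simp add: theory_at_def)
  then have "tree_value ?T (End {})" using at_end[of ?T] by (simp add: tree_value_def)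
  moreover have "arborescence X ?T" by (rule arborescenceI) (simp_all add: dstep_def acyclic_def)
  moreover have "pruned ?T" by (simp add: pruned_def retraction_of_def xtree_morphism_def)
  ultimately show ?thesis using iso_type_eq by (simp add: FLE_def)
qed

lemma bij_betw_trees_of_value:
  "bij_betw (trees_of_value X) (carrier (trunk_monoid X)) (carrier (FLE X))"
  unfolding bij_betw_def
proof
  show "inj_on (trees_of_value X) (carrier (trunk_monoid X))"
  proof (rule inj_onI)
    fix m n assume m: "m \<in> carrier (trunk_monoid X)" and eq: "trees_of_value X m = trees_of_value X n"
    obtain T where T: "T \<in> trees_of_value X m" using realize[of X m] m by auto
    show "m = n"
      using tree_value_unique[OF tree_of_valueE(1,3)[OF T]] tree_of_valueE(3)[of T X n] T eq by simp
  qed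
qed (simp add: carrier_FLE)

theorem theorem6p7:
  fixes X :: "'x set"
  shows "weakly_coherent (FLE X)"
  unfolding weakly_coherent_def weakly_left_coherent_def
proof
  show "weakly_right_coherent (FLE X)"
    by (rule weakly_right_coherent_transfer[OF monoid_trunk_monoid _ bij_betw_trees_of_value _
          right_annihilators_trunk meets_principal_trunk])
      (simp_all add: one_FLE mult_FLE)
  show "weakly_right_coherent (opposite_monoid (FLE X))"
    by (rule weakly_right_coherent_transfer[where h = "trees_of_value X",
          OF monoid_opposite[OF monoid_trunk_monoid[of X]] _ _ _
          right_annihilators_opposite_trunk meets_principal_opposite_trunk])
      (simp_all add: one_FLE mult_FLE bij_betw_trees_of_value[simplified])
qed

end
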